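(* Let $\varphi\in\mathbf{F}[x,y,z]$ be a weight homogeneous polynomial with an isolated singularity. Consider the Poisson algebra $(\mathcal{A}_\varphi,\{\cdot,\cdot\}_{\mathcal{A}_\varphi})$, where $\mathcal{A}_\varphi=\mathbf{F}[x,y,z]/\langle\varphi\rangle$. Let $u_0=1,u_1,\dots,u_{\mu-1}\in\mathbf{F}[x,y,z]$ be weight homogeneous polynomials whose images form an $\mathbf{F}$-basis of $\mathcal{A}_{sing}(\varphi)$, and let $\mathcal{K}=\{j\in\{0,\dots,\mu-1\}\mid\varpi(u_j)=\varpi(\varphi)-|\varpi|\}$. Then: (1) For every family of constants $(\alpha^n_j\in\mathbf{F})_{j\in\mathcal{K},\,n\in\mathbf{N}^*}$, the formula $$\pi_*=\{\cdot,\cdot\}_{\mathcal{A}_\varphi}+\sum_{n\in\mathbf{N}^*}\Big(\sum_{j\in\mathcal{K}}\alpha^n_j\,\wp(u_j\vec\nabla\varphi)\Big)\nu^n$$ defines a formal deformation of $\{\cdot,\cdot\}_{\mathcal{A}_\varphi}$. (2) For any formal deformation $\pi'_*$ of $\{\cdot,\cdot\}_{\mathcal{A}_\varphi}$, there exists a family of constants $(\alpha^n_j)_{j\in\mathcal{K},\,n\in\mathbf{N}^*}$ such that $\pi'_*$ is equivalent to the formal deformation $\pi_*$ given by this formula.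
   Context: $\mathbf{F}$ is a field of characteristic zero and $\mathbf{N}^*=\{1,2,\dots\}$. A polynomial $\varphi\in\mathbf{F}[x,y,z]$ is weight homogeneous of weighted degree $\varpi(\varphi)\in\mathbf{N}$ if there are (fixed) positive integers $\varpi_1,\varpi_2,\varpi_3$ without common divisor (the weights of $x,y,z$) with $\varpi_1x\frac{\partial\varphi}{\partial x}+\varpi_2y\frac{\partial\varphi}{\partial y}+\varpi_3z\frac{\partial\varphi}{\partial z}=\varpi(\varphi)\varphi$; $|\varpi|:=\varpi_1+\varpi_2+\varpi_3$. Weight homogeneity and weighted degrees $\varpi(u_j)$ of other polynomials refer to the same weights. $\varphi$ has an isolated singularity (at the origin) if $\mathcal{A}_{sing}(\varphi)=\mathbf{F}[x,y,z]/\langle\frac{\partial\varphi}{\partial x},\frac{\partial\varphi}{\partial y},\frac{\partial\varphi}{\partial z}\rangle$ is finite-dimensional over $\mathbf{F}$; its dimension is $\mu\ge1$. The Poisson bracket $\{\cdot,\cdot\}_\varphi$ on $\mathbf{F}[x,y,z]$ is determined by $\{x,y\}_\varphi=\frac{\partial\varphi}{\partial z}$, $\{y,z\}_\varphi=\frac{\partial\varphi}{\partial x}$, $\{z,x\}_\varphi=\frac{\partial\varphi}{\partial y}$. Since $\{\varphi,\cdot\}_\varphi=0$, it induces a Poisson bracket $\{\cdot,\cdot\}_{\mathcal{A}_\varphi}$ on $\mathcal{A}_\varphi$. $\wp:\mathbf{F}[x,y,z]\to\mathcal{A}_\varphi$ is the natural projection; $u\vec\nabla\varphi$ denotes the biderivation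 $u\{\cdot,\cdot\}_\varphi$ (identified with an element of $\mathbf{F}[x,y,z]^3$ by $V\mapsto(V[y,z],V[z,x],V[x,y])$), and $\wp(u\vec\nabla\varphi)$ is the skew-symmetric biderivation it induces on $\mathcal{A}_\varphi$, i.e. $\wp(u)\{\cdot,\cdot\}_{\mathcal{A}_\varphi}$. For a Poisson algebra $(\mathcal{B},\pi_0)$ over $\mathbf{F}$, a formal deformation of $\pi_0$ is a map $\pi_*=\pi_0+\pi_1\nu+\pi_2\nu^2+\cdots:\mathcal{B}[[\nu]]\times\mathcal{B}[[\nu]]\to\mathcal{B}[[\nu]]$, where each $\pi_i:\mathcal{B}\times\mathcal{B}\to\mathcal{B}$ is a skew-symmetric biderivation (extended $\mathbf{F}[[\nu]]$-bilinearly), which satisfies the Jacobi identity. Two formal deformations $\pi_*,\pi'_*$ are equivalent if there is an $\mathbf{F}[[\nu]]$-linear morphism of associative algebras $\Phi:\mathcal{B}[[\nu]]\to\mathcal{B}[[\nu]]$, equal to the identity modulo $\nu$, with $\Phi(\pi_*[F,G])=\pi'_*[\Phi(F),\Phi(G)]$ for all $F,G$. *)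

theory Defs
  imports
    "HOL-Algebra.QuotRing"
    "HOL-Computational_Algebra.Polynomial"
    "HOL-Computational_Algebra.Formal_Power_Series"
    "Jordan_Normal_Form.VS_Connect"
begin

section \<open>The polynomial algebra in three variables\<close>

text \<open>Polynomials in x, y, z are elements of F[x][y][z], so \<open>z\<close> is the outermost variable.\<close>

type_synonym 'a poly3 = "'a poly poly poly"

definition const3 :: "'a::zero \<Rightarrow> 'a poly3" where
  "const3 c = [:[:[:c:]:]:]"

definition varx :: "'a::comm_semiring_1 poly3" where
  "varx = [:[:[:0, 1:]:]:]"

definition vary :: "'a::comm_semiring_1 poly3" where
  "vary = [:[:0, 1:]:]"

definition varz :: "'a::comm_semiring_1 poly3" where
  "varz = [:0, 1:]"

definition dx :: "'a::field_char_0 poly3 \<Rightarrow> 'a poly3" where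
  "dx = map_poly (map_poly pderiv)"

definition dy :: "'a::field_char_0 poly3 \<Rightarrow> 'a poly3" where
  "dy = map_poly pderiv"

definition dz :: "'a::field_char_0 poly3 \<Rightarrow> 'a poly3" where
  "dz = pderiv"

definition poly3_alg :: "('a::field_char_0, 'a poly3) module" where
  "poly3_alg = ring.extend class_ring (module.fields (\<lambda>c p. const3 c * p))"

definition weight_homogeneous ::
    "nat \<Rightarrow> nat \<Rightarrow> nat \<Rightarrow> 'a::field_char_0 poly3 \<Rightarrow> nat \<Rightarrow> bool" where
  "weight_homogeneous w1 w2 w3 p d \<longleftrightarrow>
     of_nat w1 * varx * dx p + of_nat w2 * vary * dy p + of_nat w3 * varz * dz p = of_nat d * p"


section \<open>Quotient algebras and isolated singularities\<close>

definition quot_alg :: "('k, 'b, 'm) module_scheme \<Rightarrow> 'b set \<Rightarrow> ('k, 'b set) module" where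
  "quot_alg B I = ring.extend (B Quot I)
     (module.fields (\<lambda>c X. \<Union>a\<in>X. I +>\<^bsub>B\<^esub> (c \<odot>\<^bsub>B\<^esub> a)))"

definition jacobian_ideal :: "'a::field_char_0 poly3 \<Rightarrow> 'a poly3 set" where
  "jacobian_ideal \<phi> = Idl\<^bsub>poly3_alg\<^esub> {dx \<phi>, dy \<phi>, dz \<phi>}"

definition A_sing :: "'a::field_char_0 poly3 \<Rightarrow> ('a, 'a poly3 set) module" where
  "A_sing \<phi> = quot_alg poly3_alg (jacobian_ideal \<phi>)"

definition isolated_singularity :: "'a::field_char_0 poly3 \<Rightarrow> bool" where
  "isolated_singularity \<phi> \<longleftrightarrow> vectorspace.fin_dim class_ring (A_sing \<phi>)"

definition milnor_number :: "'a::field_char_0 poly3 \<Rightarrow> nat" where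
  "milnor_number \<phi> = vectorspace.dim class_ring (A_sing \<phi>)"

text \<open>A family, rather than a set, is a basis: repetitions have to be excluded separately.\<close>

definition basis_family :: "('k::field, 'b, 'm) module_scheme \<Rightarrow> nat \<Rightarrow> (nat \<Rightarrow> 'b) \<Rightarrow> bool" where
  "basis_family B n b \<longleftrightarrow> inj_on b {..<n} \<and> vectorspace.basis class_ring B (b ` {..<n})"

definition A_surf :: "'a::field_char_0 poly3 \<Rightarrow> ('a, 'a poly3 set) module" where
  "A_surf \<phi> = quot_alg poly3_alg (Idl\<^bsub>poly3_alg\<^esub> {\<phi>})"


section \<open>Biderivations\<close>

definition derivation :: "('k::comm_ring_1, 'b, 'm) module_scheme \<Rightarrow> ('b \<Rightarrow> 'b) \<Rightarrow> bool" where
  "derivation B D \<longleftrightarrow> D \<in> module_hom class_ring B B \<and>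
     (\<forall>a\<in>carrier B. \<forall>b\<in>carrier B. D (a \<otimes>\<^bsub>B\<^esub> b) = D a \<otimes>\<^bsub>B\<^esub> b \<oplus>\<^bsub>B\<^esub> a \<otimes>\<^bsub>B\<^esub> D b)"

definition skew_biderivation ::
    "('k::comm_ring_1, 'b, 'm) module_scheme \<Rightarrow> ('b \<Rightarrow> 'b \<Rightarrow> 'b) \<Rightarrow> bool" where
  "skew_biderivation B V \<longleftrightarrow>
     (\<forall>a\<in>carrier B. \<forall>b\<in>carrier B. V a b = \<ominus>\<^bsub>B\<^esub> V b a) \<and>
     (\<forall>a\<in>carrier B. derivation B (V a)) \<and>
     (\<forall>b\<in>carrier B. derivation B (\<lambda>a. V a b))"

text \<open>The bracket with \<open>{x, y} = dz \<phi>\<close>, \<open>{y, z} = dx \<phi>\<close>, \<open>{z, x} = dy \<phi>\<close>, extended to all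
  polynomials by the Leibniz rule.  That it is the only skew-symmetric biderivation with these
  values is \<open>jac_bracket_unique\<close> below.\<close>

definition jac_bracket :: "'a::field_char_0 poly3 \<Rightarrow> 'a poly3 \<Rightarrow> 'a poly3 \<Rightarrow> 'a poly3" where
  "jac_bracket \<phi> p q =
     dx \<phi> * (dy p * dz q - dz p * dy q) +
     dy \<phi> * (dz p * dx q - dx p * dz q) +
     dz \<phi> * (dx p * dy q - dy p * dx q)"

definition mult_grad :: "'a::field_char_0 poly3 \<Rightarrow> 'a poly3 \<Rightarrow> 'a poly3 \<Rightarrow> 'a poly3 \<Rightarrow> 'a poly3" where
  "mult_grad u \<phi> p q = u * jac_bracket \<phi> p q"

text \<open>The operation on cosets induced by \<open>V\<close>, in the style of \<open>rcoset_mult\<close>: if \<open>V\<close> is compatible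
  with \<open>I\<close>, all the cosets in the union coincide.\<close>

definition induced_op ::
    "('b, 'm) ring_scheme \<Rightarrow> 'b set \<Rightarrow> ('b \<Rightarrow> 'b \<Rightarrow> 'b) \<Rightarrow> 'b set \<Rightarrow> 'b set \<Rightarrow> 'b set" where
  "induced_op B I V X Y = (\<Union>a\<in>X. \<Union>b\<in>Y. I +>\<^bsub>B\<^esub> V a b)"

definition surf_op ::
    "'a::field_char_0 poly3 \<Rightarrow> ('a poly3 \<Rightarrow> 'a poly3 \<Rightarrow> 'a poly3) \<Rightarrow>
     'a poly3 set \<Rightarrow> 'a poly3 set \<Rightarrow> 'a poly3 set" where
  "surf_op \<phi> V = induced_op poly3_alg (Idl\<^bsub>poly3_alg\<^esub> {\<phi>}) V"

definition surf_bracket ::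
    "'a::field_char_0 poly3 \<Rightarrow> 'a poly3 set \<Rightarrow> 'a poly3 set \<Rightarrow> 'a poly3 set" where
  "surf_bracket \<phi> = surf_op \<phi> (jac_bracket \<phi>)"


subsection \<open>Agreement of the explicit formulas with their characterizations\<close>

lemma dx_add: "dx (p + q) = dx p + dx q"
  unfolding dx_def by (rule poly_eqI, simp add: coeff_map_poly, rule poly_eqI, simp add: coeff_map_poly pderiv_add)
lemma dy_add: "dy (p + q) = dy p + dy q"
  unfolding dy_def by (rule poly_eqI, simp add: coeff_map_poly pderiv_add)
lemma dz_add: "dz (p + q) = dz p + dz q"
  unfolding dz_def by (rule pderiv_add)

lemma map_poly_mult_deriv:
  fixes D :: "'b::comm_ring_1 \<Rightarrow> 'b"
  assumes "\<And>a b. D (a + b) = D a + D b" "\<And>a b. D (a * b) = D a * b + a * D b"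
  shows "map_poly D (p * q) = map_poly D p * q + p * map_poly D q"
proof -
  have D0: "D 0 = 0" using assms(1)[of 0 0] by simp
  have Ds: "D (sum f A) = (\<Sum>i\<in>A. D (f i))" for f :: "nat \<Rightarrow> 'b" and A
    by (induction A rule: infinite_finite_induct) (auto simp: assms D0)
  show ?thesis
    by (rule poly_eqI) (simp add: coeff_map_poly D0 coeff_mult Ds assms(2) sum.distrib)
qed

lemma dz_mult: "dz (p * q) = dz p * q + p * dz q"
  by (simp add: dz_def pderiv_mult algebra_simps)
lemma dy_mult: "dy (p * q) = dy p * q + p * dy q"
  unfolding dy_def by (rule map_poly_mult_deriv) (simp_all add: pderiv_add pderiv_mult algebra_simps)
lemma dx_mult: "dx (p * q) = dx p * q + p * dx q"
  unfolding dx_def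
  apply (rule map_poly_mult_deriv)
  subgoal by (rule poly_eqI) (simp add: coeff_map_poly pderiv_add)
  subgoal by (rule map_poly_mult_deriv) (simp_all add: pderiv_add pderiv_mult algebra_simps)
  done

lemma partial_simps:
  "dx (const3 c) = 0" "dy (const3 c) = 0" "dz (const3 c) = 0"
  "dx varx = 1" "dy varx = 0" "dz varx = 0"
  "dx vary = 0" "dy vary = 1" "dz vary = 0"
  "dx varz = 0" "dy varz = 0" "dz varz = 1"
  by (simp_all add: dx_def dy_def dz_def const3_def varx_def vary_def varz_def pderiv_pCons map_poly_pCons
     map_poly_1 one_pCons)

lemma poly3_alg_simps:
  "carrier poly3_alg = UNIV" "a \<otimes>\<^bsub>poly3_alg\<^esub> b = a * b" "\<one>\<^bsub>poly3_alg\<^esub> = 1" "\<zero>\<^bsub>poly3_alg\<^esub> = 0"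
  "a \<oplus>\<^bsub>poly3_alg\<^esub> b = a + b" "c \<odot>\<^bsub>poly3_alg\<^esub> a = const3 c * a"
  by (simp_all add: poly3_alg_def ring.defs module.defs)

lemma const3_hom: "const3 (a + b) = const3 a + const3 b" "const3 (a * b) = const3 a * const3 b" "const3 1 = 1"
  "const3 0 = 0"
  by (simp_all add: const3_def one_pCons mult.commute)

lemma poly3_algebra: "algebra class_ring poly3_alg"
proof (rule algebraI)
  show "cring (class_ring :: 'a ring)"
    by unfold_locales
  show "cring (poly3_alg :: ('a::field_char_0, _) module)"
    apply (rule cringI)
      apply (rule abelian_groupI)
           apply (auto simp: poly3_alg_simps algebra_simps)
     apply (metis add.right_inverse)
    apply (rule comm_monoidI)
     apply (auto simp: poly3_alg_simps algebra_simps)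
    done
qed (auto simp: poly3_alg_simps const3_hom algebra_simps)

lemma poly3_uminus: "\<ominus>\<^bsub>poly3_alg\<^esub> a = - a"
proof -
  interpret algebra class_ring "poly3_alg :: ('a, _) module" by (rule poly3_algebra)
  show ?thesis by (rule minus_equality) (auto simp: poly3_alg_simps)
qed

lemma derivation_poly3_iff:
  "derivation poly3_alg D \<longleftrightarrow>
     (\<forall>p q. D (p + q) = D p + D q) \<and> (\<forall>c p. D (const3 c * p) = const3 c * D p) \<and>
     (\<forall>p q. D (p * q) = D p * q + p * D q)"
  by (auto simp: derivation_def module_hom_def poly3_alg_simps)

lemma jac_bracket_biderivation: "skew_biderivation poly3_alg (jac_bracket \<phi>)"
  by (auto simp: skew_biderivation_def derivation_poly3_iff poly3_uminus poly3_alg_simps jac_bracket_def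
     dx_add dy_add dz_add dx_mult dy_mult dz_mult partial_simps algebra_simps)

lemma jac_bracket_vars:
  "jac_bracket \<phi> varx vary = dz \<phi>" "jac_bracket \<phi> vary varz = dx \<phi>" "jac_bracket \<phi> varz varx = dy \<phi>"
  by (simp_all add: jac_bracket_def partial_simps)

lemma derivation_poly3_eq:
  assumes D: "derivation poly3_alg D"
  shows "D p = D varx * dx p + D vary * dy p + D varz * dz p"
proof -
  let ?E = "\<lambda>p. D varx * dx p + D vary * dy p + D varz * dz p"
  have add: "\<And>p q. D (p + q) = D p + D q" and mult: "\<And>p q. D (p * q) = D p * q + p * D q"
    and smult: "\<And>c p. D (const3 c * p) = const3 c * D p"
    using D by (auto simp: derivation_poly3_iff)
  have [simp]: "D 1 = 0" using mult[of 1 1] by simp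
  have Dc: "D (const3 c) = 0" for c using smult[of c 1] by simp
  have Eadd: "?E (p + q) = ?E p + ?E q" for p q
    by (simp add: dx_add dy_add dz_add algebra_simps)
  have Emult: "?E (p * q) = ?E p * q + p * ?E q" for p q
    by (simp add: dx_mult dy_mult dz_mult algebra_simps)
  have step: "D (p + v * q) = ?E (p + v * q)"
    if "D p = ?E p" "D q = ?E q" "D v = ?E v" for p v q
    unfolding Eadd Emult add mult using that by simp
  have v: "D varx = ?E varx" "D vary = ?E vary" "D varz = ?E varz" by (simp_all add: partial_simps)
  have 1: "D [:[:a:]:] = ?E [:[:a:]:]" for a
  proof (induction a)
    case (pCons c a)
    have "[:[:pCons c a:]:] = const3 c + varx * [:[:a:]:]" by (simp add: const3_def varx_def)
    then show ?case using step[OF _ pCons.IH v(1), of "const3 c"] by (simp add: Dc partial_simps)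
  qed (use Dc[of 0] in \<open>simp add: const3_def dx_def dy_def dz_def\<close>)
  have 2: "D [:a:] = ?E [:a:]" for a
  proof (induction a)
    case (pCons c a)
    have "[:pCons c a:] = [:[:c:]:] + vary * [:a:]" by (simp add: vary_def)
    then show ?case using step[OF 1 pCons.IH v(2)] by simp
  qed (use 1[of 0] in simp)
  show ?thesis
  proof (induction p)
    case (pCons c a)
    have "pCons c a = [:c:] + varz * a" by (simp add: varz_def)
    then show ?case using step[OF 2 pCons.IH v(3)] by simp
  qed (use 2[of 0] in simp)
qed

lemma jac_bracket_unique:
  assumes V: "skew_biderivation poly3_alg V"
    and vars: "V varx vary = dz \<phi>" "V vary varz = dx \<phi>" "V varz varx = dy \<phi>"
  shows "V = jac_bracket \<phi>"
proof (intro ext)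
  fix p q
  have skew: "V a b = - V b a" for a b
    using V unfolding skew_biderivation_def poly3_alg_simps poly3_uminus by blast
  have zero: "V a a = 0" for a
  proof -
    have "V a a + V a a = 0" using skew[of a a] by (metis add.left_inverse)
    then have "2 * V a a = 0" by (simp only: mult_2)
    then show ?thesis by simp
  qed
  have l: "V a b = V varx b * dx a + V vary b * dy a + V varz b * dz a" for a b
    using V unfolding skew_biderivation_def poly3_alg_simps by (intro derivation_poly3_eq[of "\<lambda>a. V a b" a]) blast
  have r: "V a b = V a varx * dx b + V a vary * dy b + V a varz * dz b" for a b
    using V unfolding skew_biderivation_def poly3_alg_simps by (intro derivation_poly3_eq[of "V a" b]) blast
  have s: "V vary varx = - dz \<phi>" "V varz vary = - dx \<phi>" "V varx varz = - dy \<phi>"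
    by (subst skew, simp only: vars)+
  show "V p q = jac_bracket \<phi> p q"
    apply (subst l, subst r[of varx], subst r[of vary], subst r[of varz])
    by (simp add: zero vars s jac_bracket_def algebra_simps)
qed

lemma genideal_poly3: "Idl\<^bsub>poly3_alg\<^esub> {\<phi>} = {\<phi> * r |r. True}" for \<phi> :: "'a::field_char_0 poly3"
proof -
  interpret algebra class_ring "poly3_alg :: ('a, _) module" by (rule poly3_algebra)
  have "PIdl\<^bsub>poly3_alg\<^esub> \<phi> = Idl\<^bsub>poly3_alg\<^esub> {\<phi>}"
    by (rule cgenideal_eq_genideal) (simp add: poly3_alg_simps)
  then show ?thesis by (auto simp: cgenideal_def poly3_alg_simps mult.commute)
qed

lemma coset_poly3: "I +>\<^bsub>poly3_alg\<^esub> p = {i + p |i. i \<in> I}"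
  by (auto simp: a_r_coset_def' poly3_alg_simps)

lemma quot_alg_simps:
  "carrier (quot_alg B I) = carrier (B Quot I)" "a \<otimes>\<^bsub>quot_alg B I\<^esub> b = a \<otimes>\<^bsub>B Quot I\<^esub> b"
  "\<one>\<^bsub>quot_alg B I\<^esub> = \<one>\<^bsub>B Quot I\<^esub>" "\<zero>\<^bsub>quot_alg B I\<^esub> = \<zero>\<^bsub>B Quot I\<^esub>"
  "a \<oplus>\<^bsub>quot_alg B I\<^esub> b = a \<oplus>\<^bsub>B Quot I\<^esub> b"
  "c \<odot>\<^bsub>quot_alg B I\<^esub> X = (\<Union>a\<in>X. I +>\<^bsub>B\<^esub> (c \<odot>\<^bsub>B\<^esub> a))"
  by (simp_all add: quot_alg_def ring.defs module.defs)

lemma quot_alg_smult_coset: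
  fixes I :: "'a::field_char_0 poly3 set"
  assumes "ideal I poly3_alg"
  shows "c \<odot>\<^bsub>quot_alg poly3_alg I\<^esub> (I +>\<^bsub>poly3_alg\<^esub> p) = I +>\<^bsub>poly3_alg\<^esub> (const3 c * p)"
proof -
  interpret algebra class_ring "poly3_alg :: ('a, _) module" by (rule poly3_algebra)
  interpret I: ideal I poly3_alg by fact
  have cl1: "i + j \<in> I" if "i \<in> I" "j \<in> I" for i j
    using that I.a_closed[of i j] by (auto simp: poly3_alg_simps)
  have cl2: "r * i \<in> I" if "i \<in> I" for i r
    using that I.I_l_closed[of i r] by (auto simp: poly3_alg_simps)
  have cl3: "- i \<in> I" if "i \<in> I" for i
    using cl2[OF that, of "-1"] by simp
  have z: "0 \<in> I" using I.zero_closed by (simp add: poly3_alg_simps)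
  have self: "p \<in> I +>\<^bsub>poly3_alg\<^esub> p" for p
    unfolding coset_poly3 using z by (intro CollectI exI[of _ 0]) simp
  have eq: "I +>\<^bsub>poly3_alg\<^esub> p = I +>\<^bsub>poly3_alg\<^esub> q \<longleftrightarrow> p - q \<in> I" for p q
  proof
    assume "I +>\<^bsub>poly3_alg\<^esub> p = I +>\<^bsub>poly3_alg\<^esub> q"
    with self[of p] have "p \<in> I +>\<^bsub>poly3_alg\<^esub> q" by (rule back_subst)
    then obtain i where "i \<in> I" "p = i + q" unfolding coset_poly3 by blast
    then show "p - q \<in> I" by simp
  next
    assume a: "p - q \<in> I"
    show "I +>\<^bsub>poly3_alg\<^esub> p = I +>\<^bsub>poly3_alg\<^esub> q"
    proof (intro Set.set_eqI iffI)
      fix x assume "x \<in> I +>\<^bsub>poly3_alg\<^esub> p"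
      then obtain i where "i \<in> I" "x = i + p" unfolding coset_poly3 by blast
      then have "x = (i + (p - q)) + q" "i + (p - q) \<in> I" using cl1[OF _ a] by simp_all
      then show "x \<in> I +>\<^bsub>poly3_alg\<^esub> q" unfolding coset_poly3 by (intro CollectI exI conjI)
    next
      fix x assume "x \<in> I +>\<^bsub>poly3_alg\<^esub> q"
      then obtain i where "i \<in> I" "x = i + q" unfolding coset_poly3 by blast
      then have "x = (i + - (p - q)) + p" "i + - (p - q) \<in> I" using cl1[OF _ cl3[OF a], of i] by simp_all
      then show "x \<in> I +>\<^bsub>poly3_alg\<^esub> p" unfolding coset_poly3 by (intro CollectI exI conjI)
    qed
  qed
  have sm: "c \<odot>\<^bsub>quot_alg poly3_alg I\<^esub> (I +>\<^bsub>poly3_alg\<^esub> p) = I +>\<^bsub>poly3_alg\<^esub> (const3 c * p)" for c p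
  proof -
    have "I +>\<^bsub>poly3_alg\<^esub> (const3 c * a) = I +>\<^bsub>poly3_alg\<^esub> (const3 c * p)" if a: "a \<in> I +>\<^bsub>poly3_alg\<^esub> p" for a
    proof -
      obtain i where "i \<in> I" "a = i + p" using a unfolding coset_poly3 by blast
      then have "const3 c * a - const3 c * p = const3 c * i" by (simp add: distrib_left)
      then show ?thesis unfolding eq using cl2[OF \<open>i \<in> I\<close>, of "const3 c"] by metis
    qed
    then show ?thesis using self[of p] unfolding quot_alg_simps poly3_alg_simps by blast
  qed
  show "c \<odot>\<^bsub>quot_alg poly3_alg I\<^esub> (I +>\<^bsub>poly3_alg\<^esub> p) = I +>\<^bsub>poly3_alg\<^esub> (const3 c * p)" by (rule sm)
qed

lemma surf_op_mult_grad_coset: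
  fixes \<phi> u p q :: "'a::field_char_0 poly3"
  defines "I \<equiv> Idl\<^bsub>poly3_alg\<^esub> {\<phi>}"
  shows "surf_op \<phi> (mult_grad u \<phi>) (I +>\<^bsub>poly3_alg\<^esub> p) (I +>\<^bsub>poly3_alg\<^esub> q)
    = I +>\<^bsub>poly3_alg\<^esub> (u * jac_bracket \<phi> p q)"
proof -
  have I: "I = {\<phi> * r |r. True}" by (simp add: I_def genideal_poly3)
  have exp: "jac_bracket \<phi> (\<phi> * r + p) (\<phi> * s + q) = jac_bracket \<phi> p q + \<phi> * 
     (jac_bracket \<phi> r (\<phi> * s + q) + jac_bracket \<phi> p s)" for r s
    by (simp add: jac_bracket_def dx_add dy_add dz_add dx_mult dy_mult dz_mult algebra_simps)
  have 2: "I +>\<^bsub>poly3_alg\<^esub> p = {\<phi> * r + p |r. True}" for p by (auto simp: coset_poly3 I)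
  have 1: "I +>\<^bsub>poly3_alg\<^esub> (u * jac_bracket \<phi> (\<phi> * r + p) (\<phi> * s + q)) = I +>\<^bsub>poly3_alg\<^esub> (u * jac_bracket \<phi> p q)" for r s
  proof -
    have s: "{\<phi> * i + (\<phi> * t + w) |i. True} = {\<phi> * i + w |i. True}" for t w
    proof -
      have "\<phi> * i + (\<phi> * t + w) = \<phi> * (i + t) + w" "\<phi> * i + w = \<phi> * (i - t) + (\<phi> * t + w)" for i
        by (simp_all add: algebra_simps)
      then show ?thesis by blast
    qed
    have "u * jac_bracket \<phi> (\<phi> * r + p) (\<phi> * s + q) = \<phi> * (u * (jac_bracket \<phi> r (\<phi> * s + q) + jac_bracket \<phi> p s)) +
       u * jac_bracket \<phi> p q"
      unfolding exp by (simp add: algebra_simps)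
    then show ?thesis unfolding 2 by (simp only: s)
  qed
  have "surf_op \<phi> (mult_grad u \<phi>) (I +>\<^bsub>poly3_alg\<^esub> p) (I +>\<^bsub>poly3_alg\<^esub> q) =
     (\<Union>r. \<Union>s. I +>\<^bsub>poly3_alg\<^esub> (u * jac_bracket \<phi> (\<phi> * r + p) (\<phi> * s + q)))"
    unfolding surf_op_def induced_op_def mult_grad_def I_def[symmetric] 2[of p] 2[of q]
    by blast
  then show ?thesis unfolding 1 by simp
qed

lemma surf_bracket_coset:
  fixes \<phi> p q :: "'a::field_char_0 poly3"
  defines "I \<equiv> Idl\<^bsub>poly3_alg\<^esub> {\<phi>}"
  shows "surf_bracket \<phi> (I +>\<^bsub>poly3_alg\<^esub> p) (I +>\<^bsub>poly3_alg\<^esub> q) = I +>\<^bsub>poly3_alg\<^esub> jac_bracket \<phi> p q"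
proof -
  have "mult_grad 1 \<phi> = jac_bracket \<phi>" by (intro ext) (simp add: mult_grad_def)
  then show ?thesis using surf_op_mult_grad_coset[of \<phi> 1 p q] by (simp add: surf_bracket_def I_def)
qed


section \<open>Formal deformations\<close>

text \<open>\<open>B[[\<nu>]]\<close> as an algebra over the ring \<open>'k fps\<close> of formal power series.\<close>

definition fps_alg :: "('k::comm_ring_1, 'b, 'm) module_scheme \<Rightarrow> ('k fps, nat \<Rightarrow> 'b) module" where
  "fps_alg B = \<lparr>
     carrier = {f. \<forall>n. f n \<in> carrier B},
     monoid.mult = (\<lambda>f g n. \<Oplus>\<^bsub>B\<^esub>i\<in>{..n}. f i \<otimes>\<^bsub>B\<^esub> g (n - i)),
     one = (\<lambda>n. if n = 0 then \<one>\<^bsub>B\<^esub> else \<zero>\<^bsub>B\<^esub>),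
     zero = (\<lambda>n. \<zero>\<^bsub>B\<^esub>),
     add = (\<lambda>f g n. f n \<oplus>\<^bsub>B\<^esub> g n),
     smult = (\<lambda>c f n. \<Oplus>\<^bsub>B\<^esub>i\<in>{..n}. fps_nth c i \<odot>\<^bsub>B\<^esub> f (n - i))\<rparr>"

text \<open>The map \<open>\<pi> 0 + \<pi> 1 \<nu> + \<pi> 2 \<nu>\<^sup>2 + \<dots>\<close> on \<open>B[[\<nu>]]\<close>: the coefficient of \<open>\<nu>\<^sup>n\<close> in its value at
  \<open>(F, G)\<close> is the sum of \<open>\<pi> i (F j) (G k)\<close> over \<open>i + j + k = n\<close>.\<close>

definition deform_map ::
    "('b, 'm) ring_scheme \<Rightarrow> (nat \<Rightarrow> 'b \<Rightarrow> 'b \<Rightarrow> 'b) \<Rightarrow> (nat \<Rightarrow> 'b) \<Rightarrow> (nat \<Rightarrow> 'b) \<Rightarrow> nat \<Rightarrow> 'b" where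
  "deform_map B \<pi> F G n =
     (\<Oplus>\<^bsub>B\<^esub>i\<in>{..n}. \<Oplus>\<^bsub>B\<^esub>j\<in>{..n - i}. \<pi> i (F j) (G (n - i - j)))"

definition jacobi :: "('b, 'm) ring_scheme \<Rightarrow> ('b \<Rightarrow> 'b \<Rightarrow> 'b) \<Rightarrow> bool" where
  "jacobi B P \<longleftrightarrow> (\<forall>a\<in>carrier B. \<forall>b\<in>carrier B. \<forall>c\<in>carrier B.
     P (P a b) c \<oplus>\<^bsub>B\<^esub> P (P b c) a \<oplus>\<^bsub>B\<^esub> P (P c a) b = \<zero>\<^bsub>B\<^esub>)"

text \<open>A deformation is given by its sequence of coefficients \<open>\<pi>\<close>.  Operations matter only on
  the carrier.  At order 0 the Jacobi identity says that \<open>\<pi>0\<close> is a Poisson bracket.\<close>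

definition formal_deformation ::
    "('k::comm_ring_1, 'b, 'm) module_scheme \<Rightarrow> ('b \<Rightarrow> 'b \<Rightarrow> 'b) \<Rightarrow> (nat \<Rightarrow> 'b \<Rightarrow> 'b \<Rightarrow> 'b) \<Rightarrow> bool" where
  "formal_deformation B \<pi>0 \<pi> \<longleftrightarrow>
     (\<forall>a\<in>carrier B. \<forall>b\<in>carrier B. \<pi> 0 a b = \<pi>0 a b) \<and>
     (\<forall>i. skew_biderivation B (\<pi> i)) \<and>
     jacobi (fps_alg B) (deform_map B \<pi>)"

definition equivalent_deformations ::
    "('k::comm_ring_1, 'b, 'm) module_scheme \<Rightarrow>
     (nat \<Rightarrow> 'b \<Rightarrow> 'b \<Rightarrow> 'b) \<Rightarrow> (nat \<Rightarrow> 'b \<Rightarrow> 'b \<Rightarrow> 'b) \<Rightarrow> bool" where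
  "equivalent_deformations B \<pi> \<pi>' \<longleftrightarrow>
     (\<exists>\<Phi>. \<Phi> \<in> Ring.ring_hom (fps_alg B) (fps_alg B) \<and>
          \<Phi> \<in> module_hom class_ring (fps_alg B) (fps_alg B) \<and>
          (\<forall>F\<in>carrier (fps_alg B). \<Phi> F 0 = F 0) \<and>
          (\<forall>F\<in>carrier (fps_alg B). \<forall>G\<in>carrier (fps_alg B).
             \<Phi> (deform_map B \<pi> F G) = deform_map B \<pi>' (\<Phi> F) (\<Phi> G)))"

definition surf_deformation ::
    "'a::field_char_0 poly3 \<Rightarrow> (nat \<Rightarrow> 'a poly3) \<Rightarrow> nat set \<Rightarrow> (nat \<Rightarrow> nat \<Rightarrow> 'a) \<Rightarrow>
     nat \<Rightarrow> 'a poly3 set \<Rightarrow> 'a poly3 set \<Rightarrow> 'a poly3 set" where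
  "surf_deformation \<phi> u K \<alpha> n X Y =
     (if n = 0 then surf_bracket \<phi> X Y
      else (\<Oplus>\<^bsub>A_surf \<phi>\<^esub>j\<in>K. \<alpha> n j \<odot>\<^bsub>A_surf \<phi>\<^esub> surf_op \<phi> (mult_grad (u j) \<phi>) X Y))"

end

theory Submission
  imports Defs
begin

text \<open>
  Since \<open>dx \<phi>\<close>, \<open>dy \<phi>\<close>, \<open>dz \<phi>\<close> generate an ideal containing powers of the three variables, their
  Koszul complex is exact, and this forces every skew-symmetric biderivation of the surface algebra to
  be a multiple of the bracket.  Conversely the Jacobi identity holds for every multiple \<open>V * {_, _}\<close>,
  because the bracket is a bivector of rank two.  So formal deformations are
  the power series \<open>V\<close> with constant term 1.  For a power series \<open>\<sigma>\<close> with constant term 1 the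
  substitution \<open>x \<mapsto> \<sigma> ^ w1 * x\<close>, \<open>y \<mapsto> \<sigma> ^ w2 * y\<close>, \<open>z \<mapsto> \<sigma> ^ w3 * z\<close> is an automorphism of
  the deformed surface algebra, and it turns \<open>V * {_, _}\<close> into \<open>W * {_, _}\<close> as soon as
  \<open>\<sigma> ^ (w1 + w2 + w3) * W * (\<sigma> + E \<sigma>) = V(\<sigma> \<cdot> x) * \<sigma> ^ (d + 1)\<close>, with \<open>E\<close> the Euler
  field.  At each order in \<open>\<nu>\<close> this equation for \<open>\<sigma>\<close> and \<open>W\<close> reads
  \<open>(E - (d - (w1 + w2 + w3))) \<sigma>\<^sub>n + W\<^sub>n = r\<^sub>n\<close> with \<open>r\<^sub>n\<close> known, so it is solvable with \<open>W\<^sub>n\<close>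
  homogeneous of degree \<open>d - (w1 + w2 + w3)\<close>.  The Jacobian ideal vanishes in that degree, hence
  \<open>W\<^sub>n\<close> is a combination of the \<open>u j\<close> with \<open>j \<in> K\<close>.
\<close>

section \<open>Weighted degrees\<close>

text \<open>Horner's scheme peels off the three nested levels, innermost variable first, so closure
  under sums and products reaches every polynomial.\<close>

lemma poly3_induct [case_names const varx vary varz add mult]:
  fixes P :: "'a::comm_semiring_1 poly3 \<Rightarrow> bool"
  assumes const: "\<And>c. P (const3 c)" and x: "P varx" and y: "P vary" and z: "P varz"
    and add: "\<And>p q. P p \<Longrightarrow> P q \<Longrightarrow> P (p + q)" and mult: "\<And>p q. P p \<Longrightarrow> P q \<Longrightarrow> P (p * q)"
  shows "P p"
proof -
  have 1: "P [:[:a:]:]" for a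
  proof (induction a)
    case (pCons c a)
    have "[:[:pCons c a:]:] = const3 c + varx * [:[:a:]:]" by (simp add: const3_def varx_def)
    then show ?case using add[OF const mult[OF x pCons.IH]] by simp
  qed (use const[of 0] in \<open>simp add: const3_def\<close>)
  have 2: "P [:a:]" for a
  proof (induction a)
    case (pCons c a)
    have "[:pCons c a:] = [:[:c:]:] + vary * [:a:]" by (simp add: vary_def)
    then show ?case using add[OF 1 mult[OF y pCons.IH]] by simp
  qed (use 1[of 0] in simp)
  show ?thesis
  proof (induction p)
    case (pCons c a)
    have "pCons c a = [:c:] + varz * a" by (simp add: varz_def)
    then show ?case using add[OF 2 mult[OF z pCons.IH]] by simp
  qed (use 2[of 0] in simp)
qed

text \<open>Handles one level of nesting: three applications make \<open>weight_subst\<close> a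
  homomorphism, and one more does the same for \<open>rescale_const\<close>.\<close>

lemma (in comm_ring_hom) comm_ring_hom_poly: "comm_ring_hom (\<lambda>p. poly (map_poly hom p) X)"
proof -
  have "map_poly hom (p + q) = map_poly hom p + map_poly hom q" for p q
    by (rule poly_eqI) (simp add: coeff_map_poly hom_distribs)
  moreover have "map_poly hom (p * q) = map_poly hom p * map_poly hom q" for p q
    by (rule poly_eqI) (simp add: coeff_map_poly coeff_mult hom_distribs)
  moreover have "map_poly hom 1 = 1"
    by (simp add: map_poly_1)
  ultimately show ?thesis by unfold_locales simp_all
qed

lemma comm_ring_hom_const_poly: "comm_ring_hom (\<lambda>c. [:const3 c:] :: 'a::comm_ring_1 poly3 poly)"
  by unfold_locales (simp_all add: const3_def one_pCons mult.commute)

lemma of_nat_poly3: "(of_nat n :: 'a::field_char_0 poly3) = const3 (of_nat n)"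
  by (simp add: const3_def of_nat_poly)

lemma partial_of_nat:
  "dx (of_nat n * p) = of_nat n * dx p" "dy (of_nat n * p) = of_nat n * dy p" "dz (of_nat n * p) = of_nat n * dz p"
  by (simp_all add: of_nat_poly3 dx_mult dy_mult dz_mult partial_simps)

lemma partial_0: "dx 0 = 0" "dy 0 = 0" "dz 0 = 0" "dx 1 = 0" "dy 1 = 0" "dz 1 = 0"
  by (simp_all add: dx_def dy_def dz_def map_poly_1 pderiv_1)

lemma partial_uminus: "dx (- p) = - dx p" "dy (- p) = - dy p" "dz (- p) = - dz p"
  using dx_add[of p "-p"] dy_add[of p "-p"] dz_add[of p "-p"] by (simp_all add: partial_0 add_eq_0_iff)

lemma partial_diff: "dx (p - q) = dx p - dx q" "dy (p - q) = dy p - dy q" "dz (p - q) = dz p - dz q"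
  using dx_add[of p "-q"] dy_add[of p "-q"] dz_add[of p "-q"] by (simp_all add: partial_uminus)

lemma partial_commute: "dy (dx p) = dx (dy p)" "dz (dx p) = dx (dz p)" "dz (dy p) = dy (dz p)"
  by (induction p rule: poly3_induct)
    (simp_all add: partial_simps partial_0 dx_add dy_add dz_add dx_mult dy_mult dz_mult algebra_simps)

section \<open>The Euler field and homogeneous components\<close>

definition euler :: "nat \<Rightarrow> nat \<Rightarrow> nat \<Rightarrow> 'a::field_char_0 poly3 \<Rightarrow> 'a poly3" where
  "euler w1 w2 w3 p = of_nat w1 * varx * dx p + of_nat w2 * vary * dy p + of_nat w3 * varz * dz p"

text \<open>Substituting \<open>t ^ w1 * x\<close>, \<open>t ^ w2 * y\<close>, \<open>t ^ w3 * z\<close> for \<open>x\<close>, \<open>y\<close>, \<open>z\<close> separates the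
  homogeneous components of a polynomial: the one of degree \<open>k\<close> is the coefficient of \<open>t ^ k\<close>.\<close>

definition weight_subst :: "nat \<Rightarrow> nat \<Rightarrow> nat \<Rightarrow> 'a::field_char_0 poly3 \<Rightarrow> 'a poly3 poly" where
  "weight_subst w1 w2 w3 p =
     poly (map_poly (\<lambda>q. poly (map_poly (\<lambda>r. poly (map_poly (\<lambda>c. [:const3 c:]) r)
       (monom varx w1)) q) (monom vary w2)) p) (monom varz w3)"

locale weights =
  fixes w1 w2 w3 :: nat
  assumes w1_pos: "w1 > 0" and w2_pos: "w2 > 0" and w3_pos: "w3 > 0"
begin

abbreviation E :: "'a::field_char_0 poly3 \<Rightarrow> 'a poly3" where "E \<equiv> euler w1 w2 w3"

abbreviation G :: "'a::field_char_0 poly3 \<Rightarrow> 'a poly3 poly" where "G \<equiv> weight_subst w1 w2 w3"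

definition hcomp :: "nat \<Rightarrow> 'a::field_char_0 poly3 \<Rightarrow> 'a poly3" where
  "hcomp k p = coeff (G p) k"

sublocale G: comm_ring_hom "G :: 'a::field_char_0 poly3 \<Rightarrow> 'a poly3 poly"
  unfolding weight_subst_def
  by (intro comm_ring_hom.comm_ring_hom_poly comm_ring_hom_const_poly)

lemma G_simps:
  "G (const3 c) = [:const3 c:]" "G varx = monom varx w1" "G vary = monom vary w2" "G varz = monom varz w3"
  by (simp_all add: weight_subst_def const3_def varx_def vary_def varz_def map_poly_pCons pCons_one)

lemma E_add: "E (p + q) = E p + E q"
  by (simp add: euler_def dx_add dy_add dz_add algebra_simps)

lemma E_0: "E 0 = 0" "E 1 = 0"
  by (simp_all add: euler_def partial_0)

lemma E_diff: "E (p - q) = E p - E q"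
  by (simp add: euler_def partial_diff algebra_simps)

lemma E_mult: "E (p * q) = E p * q + p * E q"
  by (simp add: euler_def dx_mult dy_mult dz_mult algebra_simps)

lemma E_const3: "E (const3 c) = 0"
  by (simp add: euler_def partial_simps)

lemma E_vars: "E varx = of_nat w1 * varx" "E vary = of_nat w2 * vary" "E varz = of_nat w3 * varz"
  by (simp_all add: euler_def partial_simps)

lemma pderiv_monom_var: "monom (1::'a::field_char_0 poly3) 1 * pderiv (monom v w) = of_nat w * monom v w"
  by (cases w) (simp_all add: pderiv_monom mult_monom of_nat_poly smult_monom mult.commute)

text \<open>Both sides are derivations along the homomorphism \<open>G\<close>, so comparing them on
  constants and variables suffices.\<close>

lemma G_E: "G (E p) = monom 1 1 * pderiv (G p)"
proof (induction p rule: poly3_induct)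
  case (const c)
  then show ?case by (simp add: E_const3 G_simps pderiv_pCons)
next
  case (add p q)
  then show ?case by (simp add: E_add G.hom_add pderiv_add distrib_left)
next
  case (mult p q)
  then show ?case by (simp add: E_mult G.hom_add G.hom_mult pderiv_mult algebra_simps)
qed (simp_all only: E_vars G.hom_mult G.hom_of_nat G_simps pderiv_monom_var)

text \<open>Again two derivations along \<open>G\<close> that agree on generators. Reading off the
  coefficient of \<open>t ^ k\<close> will make it an eigenvector of \<open>E\<close> with
  eigenvalue \<open>k\<close>.\<close>

lemma map_E_G: "map_poly E (G p) = monom 1 1 * pderiv (G p)"
proof (induction p rule: poly3_induct)
  case (const c)
  then show ?case by (simp add: E_const3 G_simps pderiv_pCons map_poly_pCons E_0)
next
  case (add p q)
  have "map_poly E (G p + G q) = map_poly E (G p) + map_poly E (G q)"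
    by (rule poly_eqI) (simp add: coeff_map_poly E_add E_0)
  with add show ?case by (simp add: G.hom_add pderiv_add distrib_left)
next
  case (mult p q)
  then show ?case
    by (simp add: G.hom_mult pderiv_mult map_poly_mult_deriv[of E] E_add E_mult algebra_simps)
qed (simp_all only: G_simps pderiv_monom_var, simp_all add: map_poly_monom E_0 E_vars,
  simp_all add: of_nat_poly smult_monom)

lemma coeff_t_pderiv: "coeff (monom 1 1 * pderiv g) k = of_nat k * coeff g k"
  by (cases k) (simp_all add: coeff_monom_mult coeff_pderiv)

lemma hcomp_E: "hcomp k (E p) = of_nat k * hcomp k p"
  by (simp only: hcomp_def G_E coeff_t_pderiv)

lemma E_hcomp: "E (hcomp k p) = of_nat k * hcomp k p"
proof -
  have "E (hcomp k p) = coeff (map_poly E (G p)) k" by (simp add: hcomp_def coeff_map_poly E_0)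
  then show ?thesis by (simp only: map_E_G coeff_t_pderiv hcomp_def)
qed

lemma poly_G_1: "poly (G p) 1 = p"
  by (induction p rule: poly3_induct) (simp_all add: G_simps poly_monom G.hom_add G.hom_mult)

lemma sum_hcomp: "p = (\<Sum>k\<le>degree (G p). hcomp k p)"
  using poly_G_1[of p] by (simp add: poly_altdef hcomp_def)

lemma hcomp_add: "hcomp k (p + q) = hcomp k p + hcomp k q"
  by (simp add: hcomp_def G.hom_add)

lemma hcomp_0 [simp]: "hcomp k 0 = 0"
  by (simp add: hcomp_def)

lemma hcomp_sum: "hcomp k (sum f A) = (\<Sum>i\<in>A. hcomp k (f i))"
  by (induction A rule: infinite_finite_induct) (auto simp: hcomp_add)

lemma hcomp_const3_mult: "hcomp k (const3 c * p) = const3 c * hcomp k p"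
  by (simp add: hcomp_def G.hom_mult G_simps)

text \<open>Degrees are integers because each partial derivative lowers them by a weight, possibly
  below zero, where only the zero polynomial is homogeneous.\<close>

definition homogeneous :: "'a::field_char_0 poly3 \<Rightarrow> int \<Rightarrow> bool" where
  "homogeneous p k \<longleftrightarrow> E p = of_int k * p"

lemma homogeneous_iff: "weight_homogeneous w1 w2 w3 p k \<longleftrightarrow> homogeneous p (int k)"
  by (simp add: weight_homogeneous_def homogeneous_def euler_def)

lemma homogeneous_hcomp: "homogeneous (hcomp k p) (int k)"
  by (simp add: homogeneous_def E_hcomp)

lemma homogeneous_mult: "homogeneous p k \<Longrightarrow> homogeneous q l \<Longrightarrow> homogeneous (p * q) (k + l)"
  by (simp add: homogeneous_def E_mult algebra_simps)

lemma homogeneous_add: "homogeneous p k \<Longrightarrow> homogeneous q k \<Longrightarrow> homogeneous (p + q) k"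
  by (simp add: homogeneous_def E_add algebra_simps)

lemma homogeneous_diff: "homogeneous p k \<Longrightarrow> homogeneous q k \<Longrightarrow> homogeneous (p - q) k"
  by (simp add: homogeneous_def E_diff algebra_simps)

text \<open>Computing \<open>hcomp k (E p)\<close> in two ways gives the eigenvalues
  \<open>k\<close> and \<open>l\<close>. In characteristic zero distinct ones force the component to
  vanish, so the remaining component is all of \<open>p\<close>.\<close>

lemma hcomp_homogeneous:
  assumes "homogeneous p l"
  shows "hcomp k p = (if int k = l then p else 0)"
proof -
  have z: "hcomp k p = 0" if "int k \<noteq> l" for k
  proof -
    have "G (of_int l * p) = of_int l * G p" by (simp add: G.hom_mult G.hom_of_int)
    then have "of_nat k * hcomp k p = of_int l * hcomp k p"
      using assms hcomp_E[of k p] by (simp add: homogeneous_def hcomp_def of_int_poly)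
    then have "of_int (int k - l) * hcomp k p = 0" by (simp add: algebra_simps)
    then have "(of_int (int k - l) :: 'a poly3) = 0 \<or> hcomp k p = 0" by (simp only: mult_eq_0_iff)
    then show ?thesis using that by (simp only: of_int_eq_0_iff) simp
  qed
  have "hcomp k p = p" if "int k = l"
  proof -
    have "p = (\<Sum>j\<le>degree (G p). if j = k then hcomp j p else 0)"
      by (subst (1) sum_hcomp, rule sum.cong) (use z that in auto)
    also have "\<dots> = hcomp k p"
      by (auto simp: hcomp_def coeff_eq_0)
    finally show ?thesis by simp
  qed
  with z show ?thesis by auto
qed

lemma homogeneous_negative: "homogeneous p l \<Longrightarrow> l < 0 \<Longrightarrow> p = 0"
  by (subst sum_hcomp) (simp add: hcomp_homogeneous)

lemma G_homogeneous:
  assumes "homogeneous p (int k)"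
  shows "G p = monom p k"
  by (rule poly_eqI) (use hcomp_homogeneous[OF assms] in \<open>auto simp: hcomp_def\<close>)

text \<open>A homogeneous factor becomes a monomial under \<open>G\<close>, so multiplication by it
  merely shifts coefficients.\<close>

lemma hcomp_mult_homogeneous:
  assumes a: "homogeneous a l"
  shows "hcomp n (g * a) = (if 0 \<le> l \<and> l \<le> int n then hcomp (n - nat l) g * a else 0)"
proof (cases "l < 0")
  case True
  then show ?thesis using homogeneous_negative[OF a] by simp
next
  case False
  then obtain k where l: "l = int k" by (metis nonneg_int_cases not_less)
  have "hcomp n (g * a) = coeff (monom a k * G g) n"
    using G_homogeneous[of a k] a by (simp add: hcomp_def G.hom_mult l mult.commute)
  also have "\<dots> = (if k \<le> n then hcomp (n - k) g * a else 0)"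
    by (simp add: coeff_monom_mult hcomp_def mult.commute)
  finally show ?thesis by (simp add: l)
qed

text \<open>The commutator of \<open>dx\<close> with \<open>E\<close> is \<open>w1 * dx\<close>, and
  likewise for the other two variables.\<close>

lemma homogeneous_partial:
  assumes "homogeneous p k"
  shows "homogeneous (dx p) (k - int w1)" "homogeneous (dy p) (k - int w2)" "homogeneous (dz p) (k - int w3)"
proof -
  have i: "of_int k * q = const3 (of_int k) * q" for q :: "'a poly3" by (simp add: const3_def of_int_poly)
  have "dx (E p) = of_nat w1 * dx p + E (dx p)" "dy (E p) = of_nat w2 * dy p + E (dy p)"
    "dz (E p) = of_nat w3 * dz p + E (dz p)"
    by (simp_all add: euler_def dx_add dy_add dz_add mult.assoc partial_of_nat partial_of_nat[of _ 1, simplified partial_0, simplified] dx_mult dy_mult dz_mult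
       partial_simps partial_commute algebra_simps)
  moreover have "dx (E p) = of_int k * dx p" "dy (E p) = of_int k * dy p" "dz (E p) = of_int k * dz p"
    using assms unfolding homogeneous_def
    by (simp_all only: i dx_mult dy_mult dz_mult partial_simps mult_zero_left add_0_left)
  ultimately show "homogeneous (dx p) (k - int w1)" "homogeneous (dy p) (k - int w2)" "homogeneous (dz p) (k - int w3)"
    unfolding homogeneous_def by (simp_all add: algebra_simps)
qed

lemma homogeneous_power:
  assumes "homogeneous v k"
  shows "homogeneous (v ^ n) (int n * k)"
proof (induction n)
  case 0
  then show ?case by (simp add: homogeneous_def E_0)
next
  case (Suc n)
  then show ?case using homogeneous_mult[OF assms Suc] by (simp add: algebra_simps)
qed

lemma homogeneous_vars: "homogeneous varx (int w1)" "homogeneous vary (int w2)" "homogeneous varz (int w3)"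
  by (simp_all add: homogeneous_def E_vars)

end

section \<open>Exactness of the Koszul complex and biderivations of the surface\<close>

lemma poly3_ring: "ring (poly3_alg :: ('a::field_char_0, 'a poly3) module)"
proof -
  interpret algebra class_ring "poly3_alg :: ('a, _) module" by (rule poly3_algebra)
  show ?thesis by (rule ring_axioms)
qed

locale poly3_ideal = ideal I poly3_alg for I :: "'a::field_char_0 poly3 set"
begin

abbreviation Q :: "('a, 'a poly3 set) module" where "Q \<equiv> quot_alg poly3_alg I"

abbreviation cs :: "'a poly3 \<Rightarrow> 'a poly3 set" where "cs p \<equiv> I +>\<^bsub>poly3_alg\<^esub> p"

lemma cs_simps:
  "cs p \<oplus>\<^bsub>Q\<^esub> cs q = cs (p + q)" "cs p \<otimes>\<^bsub>Q\<^esub> cs q = cs (p * q)" "\<zero>\<^bsub>Q\<^esub> = cs 0" "\<one>\<^bsub>Q\<^esub> = cs 1"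
  "c \<odot>\<^bsub>Q\<^esub> cs p = cs (const3 c * p)"
proof -
  interpret algebra class_ring "poly3_alg :: ('a, _) module" by (rule poly3_algebra)
  show "cs p \<oplus>\<^bsub>Q\<^esub> cs q = cs (p + q)" "cs p \<otimes>\<^bsub>Q\<^esub> cs q = cs (p * q)"
    using rcoset_mult_add[of p q] a_rcos_sum[of p q]
    by (simp_all add: quot_alg_simps FactRing_def poly3_alg_simps)
  show "\<zero>\<^bsub>Q\<^esub> = cs 0" "\<one>\<^bsub>Q\<^esub> = cs 1"
    by (auto simp add: quot_alg_simps FactRing_def poly3_alg_simps coset_poly3)
qed (rule quot_alg_smult_coset[OF ideal_axioms])

lemma carrier_Q: "carrier Q = range cs"
  by (auto simp: quot_alg_simps FactRing_def A_RCOSETS_def' poly3_alg_simps)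

lemma cs_in_carrier: "cs p \<in> carrier Q"
  by (auto simp: carrier_Q)

lemma I_0: "0 \<in> I" and I_add: "p \<in> I \<Longrightarrow> q \<in> I \<Longrightarrow> p + q \<in> I"
  and I_uminus: "p \<in> I \<Longrightarrow> - p \<in> I"
proof -
  show "0 \<in> I" "p \<in> I \<Longrightarrow> q \<in> I \<Longrightarrow> p + q \<in> I"
    using additive_subgroup.zero_closed[OF additive_subgroup_axioms]
      additive_subgroup.a_closed[OF additive_subgroup_axioms, of p q] by (simp_all add: poly3_alg_simps)
  show "p \<in> I \<Longrightarrow> - p \<in> I"
    using I_l_closed[of p "-1"] by (simp add: poly3_alg_simps)
qed

lemma cs_eq_iff: "cs p = cs q \<longleftrightarrow> p - q \<in> I"
proof
  assume "cs p = cs q"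
  moreover have "p \<in> cs p" using I_0 by (auto simp: coset_poly3 intro: exI[of _ 0])
  ultimately obtain i where "i \<in> I" "p = i + q" by (auto simp: coset_poly3)
  then show "p - q \<in> I" by simp
next
  assume d: "p - q \<in> I"
  have "i + p = (i + (p - q)) + q" "i + q = (i + - (p - q)) + p" for i by simp_all
  then show "cs p = cs q"
    unfolding coset_poly3 using I_add[OF _ d] I_add[OF _ I_uminus[OF d]] by blast
qed

lemma Q_algebra: "algebra class_ring Q"
proof (rule algebraI)
  show "cring (class_ring :: 'a ring)" by unfold_locales
  show "cring Q"
  proof (rule cringI)
    show "abelian_group Q"
    proof (rule abelian_groupI)
      fix X assume "X \<in> carrier Q"
      then obtain p where X: "X = cs p" by (auto simp: carrier_Q)
      show "\<exists>Y\<in>carrier Q. Y \<oplus>\<^bsub>Q\<^esub> X = \<zero>\<^bsub>Q\<^esub>"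
        by (rule bexI[of _ "cs (- p)"]) (simp_all add: X cs_simps cs_in_carrier)
    qed (auto simp: carrier_Q cs_simps ac_simps)
  next
    show "comm_monoid Q"
      by (rule comm_monoidI) (auto simp: carrier_Q cs_simps ac_simps)
  qed (auto simp: carrier_Q cs_simps algebra_simps)
qed (auto simp: carrier_Q cs_simps const3_hom algebra_simps)

lemma cs_uminus: "\<ominus>\<^bsub>Q\<^esub> cs p = cs (- p)"
proof -
  interpret Q: algebra class_ring Q by (rule Q_algebra)
  show ?thesis by (rule Q.minus_equality) (auto simp: cs_simps cs_in_carrier)
qed

lemma cs_finsum: "finite A \<Longrightarrow> (\<Oplus>\<^bsub>Q\<^esub>i\<in>A. cs (f i)) = cs (sum f A)"
proof (induction A rule: finite_induct)
  case empty
  interpret Q: algebra class_ring Q by (rule Q_algebra)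
  show ?case by (simp add: cs_simps)
next
  case (insert i A)
  interpret Q: algebra class_ring Q by (rule Q_algebra)
  show ?case using insert by (simp add: cs_simps cs_in_carrier Pi_def)
qed

lemma spanned:
  assumes B: "basis_family Q n (\<lambda>j. cs (u j))"
  shows "\<exists>c. p - (\<Sum>j<n. const3 (c j) * u j) \<in> I"
proof -
  interpret Q: algebra class_ring Q by (rule Q_algebra)
  interpret vectorspace class_ring Q by unfold_locales
  have inj: "inj_on (\<lambda>j. cs (u j)) {..<n}" and "cs p \<in> Q.span ((\<lambda>j. cs (u j)) ` {..<n})"
    using B cs_in_carrier by (auto simp: basis_family_def basis_def)
  then obtain a A where A: "finite A" "A \<subseteq> (\<lambda>j. cs (u j)) ` {..<n}" "cs p = Q.lincomb a A"
    unfolding Q.span_def by blast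
  obtain N where N: "N \<subseteq> {..<n}" "A = (\<lambda>j. cs (u j)) ` N" using A(2) by (auto simp: subset_image_iff)
  \<comment> \<open>Zero coefficients outside \<open>N\<close> let the combination run over all
    \<open>j < n\<close>; injectivity of the family identifies \<open>N\<close> with the set
    \<open>A\<close> of cosets.\<close>
  define c where "c j = (if j \<in> N then a (cs (u j)) else 0)" for j
  have fN: "finite N" using N(1) finite_subset by blast
  have injN: "inj_on (\<lambda>j. cs (u j)) N" using inj N(1) by (rule inj_on_subset)
  have "Q.lincomb a A = (\<Oplus>\<^bsub>Q\<^esub>j\<in>N. a (cs (u j)) \<odot>\<^bsub>Q\<^esub> cs (u j))"
    unfolding Q.lincomb_def N(2) by (rule Q.finsum_reindex) (use injN in \<open>auto simp: cs_simps cs_in_carrier\<close>)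
  also have "\<dots> = cs (\<Sum>j\<in>N. const3 (a (cs (u j))) * u j)"
    by (simp add: cs_simps cs_finsum fN)
  also have "(\<Sum>j\<in>N. const3 (a (cs (u j))) * u j) = (\<Sum>j<n. const3 (c j) * u j)"
    by (rule sum.mono_neutral_cong_left) (use N in \<open>auto simp: c_def const3_hom\<close>)
  finally show ?thesis using A(3) by (auto simp: cs_eq_iff)
qed

end

section \<open>The Jacobian ideal\<close>

lemma jacobian_ideal_ideal: "ideal (jacobian_ideal \<phi>) poly3_alg"
  unfolding jacobian_ideal_def by (rule ring.genideal_ideal[OF poly3_ring]) (simp add: poly3_alg_simps)

lemma jacobian_ideal_subset:
  "jacobian_ideal \<phi> \<subseteq> {f * dx \<phi> + g * dy \<phi> + h * dz \<phi> |f g h. True}" (is "_ \<subseteq> ?J")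
  unfolding jacobian_ideal_def
proof (rule ring.genideal_minimal[OF poly3_ring])
  have comb: "f * dx \<phi> + g * dy \<phi> + h * dz \<phi> \<in> ?J" for f g h by blast
  have inv: "inv\<^bsub>add_monoid poly3_alg\<^esub> (p :: 'a poly3) = - p" for p
    using poly3_uminus[of p] by (simp add: a_inv_def)
  have l: "x * a \<in> ?J" if "a \<in> ?J" for a x
  proof -
    obtain f g h where a: "a = f * dx \<phi> + g * dy \<phi> + h * dz \<phi>" using \<open>a \<in> ?J\<close> by blast
    show ?thesis using comb[of "x * f" "x * g" "x * h"] by (simp add: a algebra_simps)
  qed
  show "ideal ?J poly3_alg"
  proof (rule idealI[OF poly3_ring])
    show "subgroup ?J (add_monoid poly3_alg)"
    proof (rule subgroup.intro)
      fix a b assume "a \<in> ?J" "b \<in> ?J"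
      then obtain f g h f' g' h' where a: "a = f * dx \<phi> + g * dy \<phi> + h * dz \<phi>"
        and b: "b = f' * dx \<phi> + g' * dy \<phi> + h' * dz \<phi>" by blast
      show "a \<otimes>\<^bsub>add_monoid poly3_alg\<^esub> b \<in> ?J"
        using comb[of "f + f'" "g + g'" "h + h'"] by (simp add: a b poly3_alg_simps algebra_simps)
    next
      show "\<one>\<^bsub>add_monoid poly3_alg\<^esub> \<in> ?J" using comb[of 0 0 0] by (simp add: poly3_alg_simps)
    next
      fix a assume a: "a \<in> ?J"
      show "inv\<^bsub>add_monoid poly3_alg\<^esub> a \<in> ?J" using l[OF a, of "-1"] by (simp add: inv)
    qed (simp add: poly3_alg_simps)
  next
    fix a x assume a: "a \<in> ?J"
    show "x \<otimes>\<^bsub>poly3_alg\<^esub> a \<in> ?J" "a \<otimes>\<^bsub>poly3_alg\<^esub> x \<in> ?J"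
      using l[OF a, of x] by (simp_all add: poly3_alg_simps mult.commute)
  qed
  show "{dx \<phi>, dy \<phi>, dz \<phi>} \<subseteq> ?J"
    using comb[of 1 0 0] comb[of 0 1 0] comb[of 0 0 1] by simp
qed

section \<open>Powers of the variables as a regular sequence\<close>

lemma vars_power:
  "varx ^ N = [:[:monom 1 N:]:]" "vary ^ N = [:monom 1 N:]" "varz ^ N = monom 1 N"
  by (induction N)
    (simp_all add: varx_def vary_def varz_def monom_0 monom_Suc pCons_one)

text \<open>Regularity of \<open>vary ^ N\<close> modulo \<open>varx ^ N\<close>: comparing
  coefficients, the cofactor of \<open>p\<close> is \<open>q\<close> with its exponents of
  \<open>vary\<close> lowered by \<open>N\<close>.\<close>

lemma vary_power_mult_eq:
  fixes p q :: "'a::field_char_0 poly3"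
  assumes "vary ^ N * p = varx ^ N * q"
  shows "varx ^ N dvd p"
proof
  have "coeff (coeff p i) j = monom 1 N * coeff (coeff q i) (j + N)" for i j
  proof -
    have "coeff (coeff (vary ^ N * p) i) (j + N) = coeff (coeff (varx ^ N * q) i) (j + N)" by (simp only: assms)
    then show ?thesis by (simp add: vars_power coeff_monom_mult)
  qed
  then show "p = varx ^ N * map_poly (poly_shift N) q"
    by (intro poly_eqI) (simp add: vars_power coeff_map_poly coeff_poly_shift)
qed

text \<open>Regularity of \<open>varz ^ N\<close> modulo \<open>varx ^ N\<close> and
  \<open>vary ^ N\<close>, again by lowering the exponents of one variable in the cofactors.\<close>

lemma varz_power_mult_eq:
  fixes p q r :: "'a::field_char_0 poly3"
  assumes "varz ^ N * p = varx ^ N * q + vary ^ N * r"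
  shows "\<exists>s t. p = varx ^ N * s + vary ^ N * t"
proof (intro exI)
  have "coeff p i = [:monom 1 N:] * coeff q (i + N) + monom 1 N * coeff r (i + N)" for i
  proof -
    have "coeff (varz ^ N * p) (i + N) = coeff (varx ^ N * q + vary ^ N * r) (i + N)" by (simp only: assms)
    then show ?thesis by (simp add: vars_power coeff_monom_mult)
  qed
  then show "p = varx ^ N * poly_shift N q + vary ^ N * poly_shift N r"
    by (intro poly_eqI) (simp add: vars_power coeff_poly_shift)
qed

text \<open>The ideal generated by \<open>a1, a2, a3\<close> is assumed to contain a regular sequence
  \<open>X, Y, Z\<close>; the Koszul complex of \<open>a1, a2, a3\<close> is then exact in the two middle spots.\<close>

lemma koszul_exact_cross:
  fixes a1 a2 a3 :: "'r::idom"
  assumes X: "X = f1 * a1 + f2 * a2 + f3 * a3" and Y: "Y = g1 * a1 + g2 * a2 + g3 * a3"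
    and X0: "X \<noteq> 0" and reg: "\<And>p q. Y * p = X * q \<Longrightarrow> X dvd p"
    and v: "v2 * a3 = v3 * a2" "v3 * a1 = v1 * a3" "v1 * a2 = v2 * a1"
  shows "\<exists>k. v1 = k * a1 \<and> v2 = k * a2 \<and> v3 = k * a3"
proof -
  \<comment> \<open>Pairing \<open>v\<close> with the cofactors of \<open>X\<close> and
    \<open>Y\<close> gives \<open>X * v = p * a\<close> and \<open>Y * v = q * a\<close>. The
    multiplier is then \<open>p / X = q / Y\<close>, and regularity removes the denominator.\<close>
  define p where "p = f1 * v1 + f2 * v2 + f3 * v3"
  define q where "q = g1 * v1 + g2 * v2 + g3 * v3"
  have Xv: "X * v1 = p * a1" "X * v2 = p * a2" "X * v3 = p * a3"
    and Yv: "Y * v1 = q * a1" "Y * v2 = q * a2" "Y * v3 = q * a3"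
  proof -
    have "(f1 * a1 + f2 * a2 + f3 * a3) * v1 = (f1 * v1 + f2 * v2 + f3 * v3) * a1"
      "(f1 * a1 + f2 * a2 + f3 * a3) * v2 = (f1 * v1 + f2 * v2 + f3 * v3) * a2"
      "(f1 * a1 + f2 * a2 + f3 * a3) * v3 = (f1 * v1 + f2 * v2 + f3 * v3) * a3" for f1 f2 f3
    proof -
      have "(f1 * a1 + f2 * a2 + f3 * a3) * v1 - (f1 * v1 + f2 * v2 + f3 * v3) * a1
          = f2 * (v1 * a2 - v2 * a1) - f3 * (v3 * a1 - v1 * a3)"
        "(f1 * a1 + f2 * a2 + f3 * a3) * v2 - (f1 * v1 + f2 * v2 + f3 * v3) * a2
          = f3 * (v2 * a3 - v3 * a2) - f1 * (v1 * a2 - v2 * a1)"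
        "(f1 * a1 + f2 * a2 + f3 * a3) * v3 - (f1 * v1 + f2 * v2 + f3 * v3) * a3
          = f1 * (v3 * a1 - v1 * a3) - f2 * (v2 * a3 - v3 * a2)"
        by (simp_all add: algebra_simps)
      then show "(f1 * a1 + f2 * a2 + f3 * a3) * v1 = (f1 * v1 + f2 * v2 + f3 * v3) * a1"
        "(f1 * a1 + f2 * a2 + f3 * a3) * v2 = (f1 * v1 + f2 * v2 + f3 * v3) * a2"
        "(f1 * a1 + f2 * a2 + f3 * a3) * v3 = (f1 * v1 + f2 * v2 + f3 * v3) * a3"
        unfolding v by simp_all
    qed
    then show "X * v1 = p * a1" "X * v2 = p * a2" "X * v3 = p * a3"
      "Y * v1 = q * a1" "Y * v2 = q * a2" "Y * v3 = q * a3"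
      by (simp_all only: X Y p_def q_def)
  qed
  have eq: "(Y * p - X * q) * a = 0" if "X * v = p * a" "Y * v = q * a" for v a
  proof -
    have "(Y * p - X * q) * a = Y * (p * a) - X * (q * a)" by (simp add: algebra_simps)
    also have "\<dots> = 0" by (simp only: that [symmetric]) (simp add: algebra_simps)
    finally show ?thesis .
  qed
  have "(Y * p - X * q) * a1 = 0" "(Y * p - X * q) * a2 = 0" "(Y * p - X * q) * a3 = 0"
    by (rule eq[OF Xv(1) Yv(1)] eq[OF Xv(2) Yv(2)] eq[OF Xv(3) Yv(3)])+
  \<comment> \<open>Were the difference nonzero, \<open>a1\<close>, \<open>a2\<close>,
    \<open>a3\<close> would all vanish, and with them \<open>X\<close>.\<close>
  then have "Y * p = X * q" using X0 X by auto
  then have "X dvd p" by (rule reg)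
  then obtain k where "p = X * k" by (elim dvdE)
  then have "X * v1 = X * (k * a1)" "X * v2 = X * (k * a2)" "X * v3 = X * (k * a3)"
    using Xv by (simp_all add: algebra_simps)
  then show ?thesis using X0 by auto
qed

text \<open>The cross product with the cofactors of \<open>X\<close> is a contracting homotopy up to
  the factor \<open>X\<close>: it writes \<open>X * w\<close> as the cross product of
  \<open>a\<close> with \<open>p\<close>. Regularity then allows dividing by
  \<open>X\<close>.\<close>

lemma koszul_exact_dot:
  fixes a1 a2 a3 :: "'r::idom"
  assumes X: "X = f1 * a1 + f2 * a2 + f3 * a3" and Y: "Y = g1 * a1 + g2 * a2 + g3 * a3"
    and Z: "Z = h1 * a1 + h2 * a2 + h3 * a3"
    and X0: "X \<noteq> 0" and regY: "\<And>p q. Y * p = X * q \<Longrightarrow> X dvd p"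
    and regZ: "\<And>p q r. Z * p = X * q + Y * r \<Longrightarrow> \<exists>s t. p = X * s + Y * t"
    and w: "a1 * w1 + a2 * w2 + a3 * w3 = 0"
  shows "\<exists>s1 s2 s3. w1 = a2 * s3 - a3 * s2 \<and> w2 = a3 * s1 - a1 * s3 \<and> w3 = a1 * s2 - a2 * s1"
proof -
  \<comment> \<open>In vector notation \<open>p\<close> and \<open>q\<close> are the cross products
    of \<open>w\<close> with \<open>f\<close> and \<open>g\<close>, while \<open>r\<close>,
    \<open>r'\<close>, \<open>r''\<close> are the triple products of \<open>w\<close> with two of
    \<open>f\<close>, \<open>g\<close>, \<open>h\<close>.\<close>
  define p1 p2 p3 where p: "p1 = w2 * f3 - w3 * f2" "p2 = w3 * f1 - w1 * f3" "p3 = w1 * f2 - w2 * f1"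
  define q1 q2 q3 where q: "q1 = w2 * g3 - w3 * g2" "q2 = w3 * g1 - w1 * g3" "q3 = w1 * g2 - w2 * g1"
  define r where "r = w1 * (f2 * g3 - f3 * g2) + w2 * (f3 * g1 - f1 * g3) + w3 * (f1 * g2 - f2 * g1)"
  define r' where "r' = w1 * (g2 * h3 - g3 * h2) + w2 * (g3 * h1 - g1 * h3) + w3 * (g1 * h2 - g2 * h1)"
  define r'' where "r'' = w1 * (h2 * f3 - h3 * f2) + w2 * (h3 * f1 - h1 * f3) + w3 * (h1 * f2 - h2 * f1)"
  have Xw: "X * w1 = a2 * p3 - a3 * p2" "X * w2 = a3 * p1 - a1 * p3" "X * w3 = a1 * p2 - a2 * p1"
  proof -
    have "X * w1 = a2 * p3 - a3 * p2 + f1 * (a1 * w1 + a2 * w2 + a3 * w3)"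
      "X * w2 = a3 * p1 - a1 * p3 + f2 * (a1 * w1 + a2 * w2 + a3 * w3)"
      "X * w3 = a1 * p2 - a2 * p1 + f3 * (a1 * w1 + a2 * w2 + a3 * w3)"
      unfolding X p by (simp_all add: algebra_simps)
    then show "X * w1 = a2 * p3 - a3 * p2" "X * w2 = a3 * p1 - a1 * p3" "X * w3 = a1 * p2 - a2 * p1"
      unfolding w by simp_all
  qed
  have rel: "Y * p1 - X * q1 = a1 * r" "Y * p2 - X * q2 = a2 * r" "Y * p3 - X * q3 = a3 * r"
  proof -
    have "Y * p1 - X * q1 = a1 * r - (f2 * g3 - f3 * g2) * (a1 * w1 + a2 * w2 + a3 * w3)"
      "Y * p2 - X * q2 = a2 * r - (f3 * g1 - f1 * g3) * (a1 * w1 + a2 * w2 + a3 * w3)"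
      "Y * p3 - X * q3 = a3 * r - (f1 * g2 - f2 * g1) * (a1 * w1 + a2 * w2 + a3 * w3)"
      unfolding X Y p q r_def by (simp_all add: algebra_simps)
    then show "Y * p1 - X * q1 = a1 * r" "Y * p2 - X * q2 = a2 * r" "Y * p3 - X * q3 = a3 * r"
      unfolding w by simp_all
  qed
  have "Z * r = X * (- r') + Y * (- r'') + (f1 * (g2 * h3 - g3 * h2) + f2 * (g3 * h1 - g1 * h3)
      + f3 * (g1 * h2 - g2 * h1)) * (a1 * w1 + a2 * w2 + a3 * w3)"
    unfolding X Y Z r_def r'_def r''_def by (simp add: algebra_simps)
  then have "Z * r = X * (- r') + Y * (- r'')"
    unfolding w by simp
  then obtain s t where r: "r = X * s + Y * t" using regZ by blast
  \<comment> \<open>Subtracting a multiple of \<open>a\<close> from \<open>p\<close> leaves the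
    cross product of \<open>a\<close> with \<open>p\<close> unchanged; this correction makes
    \<open>p\<close> divisible by \<open>X\<close>.\<close>
  have "Y * (p1 - a1 * t) = X * (q1 + a1 * s)" "Y * (p2 - a2 * t) = X * (q2 + a2 * s)"
    "Y * (p3 - a3 * t) = X * (q3 + a3 * s)"
    using rel unfolding r by (simp_all add: algebra_simps)
  then have "X dvd p1 - a1 * t" "X dvd p2 - a2 * t" "X dvd p3 - a3 * t" using regY by blast+
  then obtain s1 s2 s3 where s: "p1 = a1 * t + X * s1" "p2 = a2 * t + X * s2" "p3 = a3 * t + X * s3"
    unfolding dvd_def diff_eq_eq by (auto simp: add.commute)
  have "X * w1 = X * (a2 * s3 - a3 * s2)" "X * w2 = X * (a3 * s1 - a1 * s3)" "X * w3 = X * (a1 * s2 - a2 * s1)"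
    unfolding Xw s by (simp_all add: algebra_simps)
  then have "w1 = a2 * s3 - a3 * s2" "w2 = a3 * s1 - a1 * s3" "w3 = a1 * s2 - a2 * s1"
    using X0 by simp_all
  then show ?thesis by blast
qed

text \<open>A derivation of the surface algebra lifts to a map on polynomials that obeys the rules
  only modulo \<phi>; induction over the generators still recovers it from its values on the
  variables.\<close>

lemma derivation_mod_eq:
  fixes D :: "'a::field_char_0 poly3 \<Rightarrow> 'a poly3"
  assumes add: "\<And>p q. \<phi> dvd D (p + q) - (D p + D q)"
    and smult: "\<And>c p. \<phi> dvd D (const3 c * p) - const3 c * D p"
    and mult: "\<And>p q. \<phi> dvd D (p * q) - (D p * q + p * D q)"
  shows "\<phi> dvd D p - (D varx * dx p + D vary * dy p + D varz * dz p)"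
proof (induction p rule: poly3_induct)
  case (const c)
  \<comment> \<open>Since \<open>1 = 1 * 1\<close>, the product rule forces \<phi> to divide
    \<open>D 1\<close>.\<close>
  have "D (1 * 1) - (D 1 * 1 + 1 * D 1) = - D 1" by simp
  then have "\<phi> dvd const3 c * D 1" using mult[of 1 1] by simp
  then have "\<phi> dvd (D (const3 c * 1) - const3 c * D 1) + const3 c * D 1" by (intro dvd_add smult)
  then show ?case by (simp add: partial_simps)
next
  case (add p q)
  let ?E = "\<lambda>p. D varx * dx p + D vary * dy p + D varz * dz p"
  have "D (p + q) - ?E (p + q) = (D (p + q) - (D p + D q)) + ((D p - ?E p) + (D q - ?E q))"
    by (simp add: dx_add dy_add dz_add algebra_simps)
  then show ?case using add.IH assms(1)[of p q] by (simp only:) (intro dvd_add)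
next
  case (mult p q)
  let ?E = "\<lambda>p. D varx * dx p + D vary * dy p + D varz * dz p"
  have "D (p * q) - ?E (p * q) = (D (p * q) - (D p * q + p * D q)) + (q * (D p - ?E p) + p * (D q - ?E q))"
    by (simp add: dx_mult dy_mult dz_mult algebra_simps)
  then show ?case using mult.IH assms(3)[of p q] by (simp only:) (intro dvd_add dvd_mult)
qed (simp_all add: partial_simps)

section \<open>The surface algebra and its biderivations\<close>

lemma poly3_ideal_genideal: "poly3_ideal (Idl\<^bsub>poly3_alg\<^esub> {\<phi>})"
  unfolding poly3_ideal_def by (rule ring.genideal_ideal[OF poly3_ring]) (simp add: poly3_alg_simps)

locale surface =
  fixes \<phi> :: "'a::field_char_0 poly3"
begin

sublocale poly3_ideal "Idl\<^bsub>poly3_alg\<^esub> {\<phi>}"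
  by (rule poly3_ideal_genideal)

lemma A_surf_eq: "A_surf \<phi> = Q"
  by (simp add: A_surf_def)

lemma cs_eq_dvd: "cs p = cs q \<longleftrightarrow> \<phi> dvd p - q"
  unfolding cs_eq_iff by (auto simp: genideal_poly3 dvd_def)

end

text \<open>The isolated singularity is recorded as \<open>spans\<close>: modulo the partial
  derivatives of \<phi>, finitely many homogeneous \<open>u j\<close> generate all
  polynomials.\<close>

locale isolated_surface = weights w1 w2 w3 + surface \<phi>
  for w1 w2 w3 :: nat and \<phi> :: "'a::field_char_0 poly3" +
  fixes d \<mu> :: nat and u :: "nat \<Rightarrow> 'a poly3" and e :: "nat \<Rightarrow> nat"
  assumes hom: "homogeneous \<phi> (int d)"
    and u_hom: "j < \<mu> \<Longrightarrow> homogeneous (u j) (int (e j))"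
    and spans: "\<exists>c f g h. p = (\<Sum>j<\<mu>. const3 (c j) * u j) + (f * dx \<phi> + g * dy \<phi> + h * dz \<phi>)"
begin

text \<open>The component of degree \<open>k\<close> of \<open>spans\<close>. A cofactor vanishes
  when its degree, \<open>k\<close> minus that of the partial derivative, would be negative.\<close>

lemma hcomp_eq_sum:
  "\<exists>c f g h. hcomp k p = (\<Sum>j \<in> {j. j < \<mu> \<and> e j = k}. const3 (c j) * u j)
    + (f * dx \<phi> + g * dy \<phi> + h * dz \<phi>) \<and> (int k < int d - int w1 \<longrightarrow> f = 0)
    \<and> (int k < int d - int w2 \<longrightarrow> g = 0) \<and> (int k < int d - int w3 \<longrightarrow> h = 0)"
proof -
  obtain c f g h where p: "p = (\<Sum>j<\<mu>. const3 (c j) * u j) + (f * dx \<phi> + g * dy \<phi> + h * dz \<phi>)"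
    using spans by blast
  have "hcomp k (\<Sum>j<\<mu>. const3 (c j) * u j) = (\<Sum>j<\<mu>. if e j = k then const3 (c j) * u j else 0)"
    unfolding hcomp_sum hcomp_const3_mult
    by (rule sum.cong) (auto simp: hcomp_homogeneous[OF u_hom])
  also have "\<dots> = (\<Sum>j \<in> {j. j < \<mu> \<and> e j = k}. const3 (c j) * u j)"
    by (rule sum.mono_neutral_cong_right) auto
  finally have u: "hcomp k (\<Sum>j<\<mu>. const3 (c j) * u j) = \<dots>" .
  have "\<exists>f'. hcomp k (f * a) = f' * a \<and> (int k < l \<longrightarrow> f' = 0)" if "homogeneous a l" for f a l
    using hcomp_mult_homogeneous[OF that, of k f] by (cases "0 \<le> l \<and> l \<le> int k") auto
  from this[OF homogeneous_partial(1)[OF hom], of f] this[OF homogeneous_partial(2)[OF hom], of g]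
    this[OF homogeneous_partial(3)[OF hom], of h]
  obtain f' g' h' where "hcomp k (f * dx \<phi>) = f' * dx \<phi>" "hcomp k (g * dy \<phi>) = g' * dy \<phi>"
    "hcomp k (h * dz \<phi>) = h' * dz \<phi>" "int k < int d - int w1 \<longrightarrow> f' = 0"
    "int k < int d - int w2 \<longrightarrow> g' = 0" "int k < int d - int w3 \<longrightarrow> h' = 0" by metis
  then show ?thesis using u p by (intro exI[of _ c] exI[of _ f'] exI[of _ g'] exI[of _ h']) (simp add: hcomp_add)
qed

text \<open>As the weights are positive, this degree lies below that of every partial derivative of
  \<phi>, so all three cofactors vanish.\<close>

lemma hcomp_critical_degree:
  assumes "int k = int d - int (w1 + w2 + w3)"
  shows "\<exists>c. hcomp k p = (\<Sum>j \<in> {j. j < \<mu> \<and> e j = k}. const3 (c j) * u j)"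
proof -
  obtain c f g h where "hcomp k p = (\<Sum>j \<in> {j. j < \<mu> \<and> e j = k}. const3 (c j) * u j)
      + (f * dx \<phi> + g * dy \<phi> + h * dz \<phi>)"
    and "int k < int d - int w1 \<longrightarrow> f = 0" "int k < int d - int w2 \<longrightarrow> g = 0" "int k < int d - int w3 \<longrightarrow> h = 0"
    using hcomp_eq_sum by blast
  moreover have "int k < int d - int w1" "int k < int d - int w2" "int k < int d - int w3"
    using assms w1_pos w2_pos w3_pos by simp_all
  ultimately show ?thesis by auto
qed

text \<open>The exponent exceeds every \<open>e j\<close>, so no \<open>u j\<close> has the degree
  of this power and only the Jacobian part is left.\<close>

lemma power_in_jacobian:
  assumes v: "homogeneous v (int w)" and w: "w > 0"
  shows "\<exists>f g h. v ^ Suc (\<Sum>j<\<mu>. e j) = f * dx \<phi> + g * dy \<phi> + h * dz \<phi>"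
proof -
  let ?N = "Suc (\<Sum>j<\<mu>. e j)"
  have "{j. j < \<mu> \<and> e j = w * ?N} = {}"
  proof -
    have "e j < w * ?N" if "j < \<mu>" for j
    proof -
      have "e j \<le> (\<Sum>j<\<mu>. e j)" using that by (intro member_le_sum) auto
      also have "\<dots> < ?N" by simp
      also have "?N = 1 * ?N" by simp
      also have "\<dots> \<le> w * ?N" by (rule mult_le_mono1) (use w in simp)
      finally show ?thesis .
    qed
    then show ?thesis by force
  qed
  moreover have "hcomp (w * n) (v ^ n) = v ^ n" for n
    by (simp add: hcomp_homogeneous[OF homogeneous_power[OF v]] mult.commute)
  moreover obtain c f g h where "hcomp (w * ?N) (v ^ ?N)
      = (\<Sum>j \<in> {j. j < \<mu> \<and> e j = w * ?N}. const3 (c j) * u j) + (f * dx \<phi> + g * dy \<phi> + h * dz \<phi>)"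
    using hcomp_eq_sum by blast
  ultimately have "v ^ ?N = f * dx \<phi> + g * dy \<phi> + h * dz \<phi>" by (simp only: sum.empty add_0_left)
  then show ?thesis by blast
qed

text \<open>The vector \<open>v\<close> of values on pairs of variables has a cross product with the
  gradient of \<phi> that is divisible by \<phi>. Exactness in one spot corrects \<open>v\<close> by
  a multiple of \<phi> so that this product vanishes; exactness in the other makes the corrected
  \<open>v\<close> a multiple of the gradient.\<close>

lemma biderivation_surface:
  assumes V: "skew_biderivation (A_surf \<phi>) V"
  shows "\<exists>k. \<forall>p q. V (cs p) (cs q) = cs (k * jac_bracket \<phi> p q)"
proof -
  have skew: "V (cs p) (cs q) = \<ominus>\<^bsub>Q\<^esub> V (cs q) (cs p)"
    and derl: "derivation Q (\<lambda>X. V X (cs q))" and derr: "derivation Q (V (cs p))" for p q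
    using V cs_in_carrier unfolding skew_biderivation_def A_surf_eq by blast+
  define \<rho> where "\<rho> p q = (SOME r. V (cs p) (cs q) = cs r)" for p q
  have \<rho>: "V (cs p) (cs q) = cs (\<rho> p q)" for p q
  proof -
    have "V (cs p) (cs q) \<in> carrier Q"
      using derr[of p] by (auto simp: derivation_def module_hom_def cs_in_carrier)
    then have "\<exists>r. V (cs p) (cs q) = cs r" unfolding carrier_Q by blast
    then show ?thesis unfolding \<rho>_def by (rule someI_ex)
  qed
  have der_mod: "\<phi> dvd D p - (D varx * dx p + D vary * dy p + D varz * dz p)"
    if D: "\<And>p. D' (cs p) = cs (D p)" and D': "derivation Q D'" for D D' p
  proof (rule derivation_mod_eq)
    fix p q
    have "D' (cs p \<oplus>\<^bsub>Q\<^esub> cs q) = D' (cs p) \<oplus>\<^bsub>Q\<^esub> D' (cs q)"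
      using D' by (simp add: derivation_def module_hom_def cs_in_carrier)
    then show "\<phi> dvd D (p + q) - (D p + D q)" by (simp add: cs_simps D cs_eq_dvd)
    have "D' (cs p \<otimes>\<^bsub>Q\<^esub> cs q) = D' (cs p) \<otimes>\<^bsub>Q\<^esub> cs q \<oplus>\<^bsub>Q\<^esub> cs p \<otimes>\<^bsub>Q\<^esub> D' (cs q)"
      using D' by (simp add: derivation_def cs_in_carrier)
    then show "\<phi> dvd D (p * q) - (D p * q + p * D q)" by (simp add: cs_simps D cs_eq_dvd)
  next
    fix c p
    have "D' (c \<odot>\<^bsub>Q\<^esub> cs p) = c \<odot>\<^bsub>Q\<^esub> D' (cs p)"
      using D' by (simp add: derivation_def module_hom_def cs_in_carrier)
    then show "\<phi> dvd D (const3 c * p) - const3 c * D p" by (simp add: cs_simps D cs_eq_dvd)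
  qed
  have expl: "\<phi> dvd \<rho> p q - (\<rho> varx q * dx p + \<rho> vary q * dy p + \<rho> varz q * dz p)" for p q
    by (rule der_mod[of "\<lambda>X. V X (cs q)"]) (simp_all add: \<rho> derl)
  have expr: "\<phi> dvd \<rho> p q - (\<rho> p varx * dx q + \<rho> p vary * dy q + \<rho> p varz * dz q)" for p q
    by (rule der_mod[of "V (cs p)"]) (simp_all add: \<rho> derr)
  have anti: "\<phi> dvd \<rho> p q + \<rho> q p" for p q
    using skew[of p q] by (simp add: \<rho> cs_uminus cs_eq_dvd)
  have diag: "\<phi> dvd \<rho> p p" for p
  proof -
    have "\<phi> dvd const3 (1/2) * (\<rho> p p + \<rho> p p)" using anti[of p p] by (rule dvd_mult)
    also have "const3 (1/2) * (\<rho> p p + \<rho> p p) = (const3 (1/2) + const3 (1/2)) * \<rho> p p"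
      by (simp only: algebra_simps)
    also have "\<dots> = \<rho> p p"
      by (simp add: const3_hom flip: const3_hom(1))
    finally show ?thesis .
  qed
  \<comment> \<open>These are the coordinates of \<open>V\<close> in the identification of
    biderivations with vectors; \<open>table\<close> shows that they determine \<open>V\<close>
    modulo \<phi>.\<close>
  define v1 v2 v3 where v: "v1 = \<rho> vary varz" "v2 = \<rho> varz varx" "v3 = \<rho> varx vary"
  have table: "\<phi> dvd \<rho> p varx - (v2 * dz p - v3 * dy p)" "\<phi> dvd \<rho> p vary - (v3 * dx p - v1 * dz p)"
    "\<phi> dvd \<rho> p varz - (v1 * dy p - v2 * dx p)" for p
  proof -
    have split: "\<phi> dvd a - b" if "\<phi> dvd a - c" "\<phi> dvd s" "\<phi> dvd t" "c = b + s * s' + t * t'" for a b c s t s' t'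
    proof -
      have "a - b = (a - c) + (s * s' + t * t')" using that(4) by simp
      then show ?thesis using that(1-3) by (simp only:) (intro dvd_add dvd_mult2)
    qed
    show "\<phi> dvd \<rho> p varx - (v2 * dz p - v3 * dy p)"
      by (rule split[OF expl[of p varx] diag[of varx] anti[of vary varx], of _ "dx p" "dy p"])
        (simp add: v algebra_simps)
    show "\<phi> dvd \<rho> p vary - (v3 * dx p - v1 * dz p)"
      by (rule split[OF expl[of p vary] diag[of vary] anti[of varz vary], of _ "dy p" "dz p"])
        (simp add: v algebra_simps)
    show "\<phi> dvd \<rho> p varz - (v1 * dy p - v2 * dx p)"
      by (rule split[OF expl[of p varz] diag[of varz] anti[of varx varz], of _ "dz p" "dx p"])
        (simp add: v algebra_simps)
  qed
  \<comment> \<open>The class of \<phi> is zero, so \<open>V\<close> vanishes on it; through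
    \<open>table\<close> this constrains \<open>v\<close>.\<close>
  have \<phi>0: "\<phi> dvd \<rho> \<phi> q" for q
  proof -
    have "cs \<phi> = cs 0" by (simp add: cs_eq_dvd)
    then have "cs (\<rho> \<phi> q) = cs (\<rho> 0 q)" using \<rho>[of \<phi> q] \<rho>[of 0 q] by simp
    then have "\<phi> dvd (\<rho> \<phi> q - \<rho> 0 q) + \<rho> 0 q"
      using expl[of 0 q] by (intro dvd_add) (simp_all add: cs_eq_dvd partial_0)
    then show ?thesis by simp
  qed
  have "\<phi> dvd v2 * dz \<phi> - v3 * dy \<phi>" "\<phi> dvd v3 * dx \<phi> - v1 * dz \<phi>" "\<phi> dvd v1 * dy \<phi> - v2 * dx \<phi>"
    using table[of \<phi>] \<phi>0 by (metis dvd_diffD diff_add_cancel dvd_add_right_iff)+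
  then obtain r1 r2 r3 where r: "v2 * dz \<phi> - v3 * dy \<phi> = \<phi> * r1" "v3 * dx \<phi> - v1 * dz \<phi> = \<phi> * r2"
    "v1 * dy \<phi> - v2 * dx \<phi> = \<phi> * r3" by (elim dvdE)
  define N where "N = Suc (\<Sum>j<\<mu>. e j)"
  obtain f1 f2 f3 where X: "varx ^ N = f1 * dx \<phi> + f2 * dy \<phi> + f3 * dz \<phi>"
    using power_in_jacobian[OF homogeneous_vars(1) w1_pos] unfolding N_def by blast
  obtain g1 g2 g3 where Y: "vary ^ N = g1 * dx \<phi> + g2 * dy \<phi> + g3 * dz \<phi>"
    using power_in_jacobian[OF homogeneous_vars(2) w2_pos] unfolding N_def by blast
  obtain h1 h2 h3 where Z: "varz ^ N = h1 * dx \<phi> + h2 * dy \<phi> + h3 * dz \<phi>"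
    using power_in_jacobian[OF homogeneous_vars(3) w3_pos] unfolding N_def by blast
  have X0: "varx ^ N \<noteq> (0 :: 'a poly3)" by (simp add: varx_def)
  have "\<phi> \<noteq> 0" using X X0 by (auto simp: partial_0)
  \<comment> \<open>The gradient is orthogonal to its cross product with \<open>v\<close>, which is
    \<phi> times \<open>r\<close>.\<close>
  moreover have "\<phi> * (dx \<phi> * r1 + dy \<phi> * r2 + dz \<phi> * r3) = 0"
    by (simp add: distrib_left mult.left_commute[of \<phi>] flip: r) (simp add: algebra_simps)
  ultimately have r0: "dx \<phi> * r1 + dy \<phi> * r2 + dz \<phi> * r3 = 0" by simp
  have "\<exists>s1 s2 s3. r1 = dy \<phi> * s3 - dz \<phi> * s2 \<and> r2 = dz \<phi> * s1 - dx \<phi> * s3 \<and> r3 = dx \<phi> * s2 - dy \<phi> * s1"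
    by (rule koszul_exact_dot[OF X Y Z X0 _ _ r0]) (erule vary_power_mult_eq, erule varz_power_mult_eq)
  then obtain s1 s2 s3 where s: "r1 = dy \<phi> * s3 - dz \<phi> * s2" "r2 = dz \<phi> * s1 - dx \<phi> * s3"
    "r3 = dx \<phi> * s2 - dy \<phi> * s1" by blast
  \<comment> \<open>Adding \<phi> times \<open>s\<close> does not change the class of
    \<open>v\<close> and cancels the right-hand sides in \<open>r\<close>.\<close>
  have vs: "(v2 + \<phi> * s2) * dz \<phi> = (v3 + \<phi> * s3) * dy \<phi>" "(v3 + \<phi> * s3) * dx \<phi> = (v1 + \<phi> * s1) * dz \<phi>"
    "(v1 + \<phi> * s1) * dy \<phi> = (v2 + \<phi> * s2) * dx \<phi>"
    using r unfolding s by (simp_all add: algebra_simps)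
  have "\<exists>k. v1 + \<phi> * s1 = k * dx \<phi> \<and> v2 + \<phi> * s2 = k * dy \<phi> \<and> v3 + \<phi> * s3 = k * dz \<phi>"
    by (rule koszul_exact_cross[OF X Y X0 _ vs]) (erule vary_power_mult_eq)
  then obtain k where k: "v1 + \<phi> * s1 = k * dx \<phi>" "v2 + \<phi> * s2 = k * dy \<phi>" "v3 + \<phi> * s3 = k * dz \<phi>" by blast
  have "V (cs p) (cs q) = cs (k * jac_bracket \<phi> p q)" for p q
  proof -
    let ?x = "v2 * dz p - v3 * dy p" and ?y = "v3 * dx p - v1 * dz p" and ?z = "v1 * dy p - v2 * dx p"
    have "\<rho> p q - k * jac_bracket \<phi> p q
      = (\<rho> p q - (\<rho> p varx * dx q + \<rho> p vary * dy q + \<rho> p varz * dz q))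
        + ((\<rho> p varx - ?x) * dx q + (\<rho> p vary - ?y) * dy q + (\<rho> p varz - ?z) * dz q)
        - \<phi> * (s1 * (dy p * dz q - dz p * dy q) + s2 * (dz p * dx q - dx p * dz q) + s3 * (dx p * dy q - dy p * dx q))"
    proof -
      have "k * jac_bracket \<phi> p q = (k * dx \<phi>) * (dy p * dz q - dz p * dy q) +
        (k * dy \<phi>) * (dz p * dx q - dx p * dz q) + (k * dz \<phi>) * (dx p * dy q - dy p * dx q)"
        by (simp add: jac_bracket_def algebra_simps)
      then show ?thesis unfolding k[symmetric] by (simp add: algebra_simps)
    qed
    then have "\<phi> dvd \<rho> p q - k * jac_bracket \<phi> p q"
      by (simp only:) (rule dvd_diff[OF dvd_add[OF expr dvd_add[OF dvd_add[OF dvd_mult2[OF table(1)]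
        dvd_mult2[OF table(2)]] dvd_mult2[OF table(3)]]] dvd_triv_left])
    then show ?thesis by (simp add: \<rho> cs_eq_dvd)
  qed
  then show ?thesis by blast
qed

end

section \<open>The bracket and the rescaling automorphisms on formal power series\<close>

definition fps_lift :: "('b \<Rightarrow> 'c) \<Rightarrow> 'b fps \<Rightarrow> 'c fps" where
  "fps_lift D F = Abs_fps (\<lambda>n. D (fps_nth F n))"

lemma fps_lift_nth [simp]: "fps_nth (fps_lift D F) n = D (fps_nth F n)"
  by (simp add: fps_lift_def)

lemma fps_lift_mult:
  fixes D :: "'b::comm_ring_1 \<Rightarrow> 'b"
  assumes "\<And>a b. D (a + b) = D a + D b" "\<And>a b. D (a * b) = D a * b + a * D b"
  shows "fps_lift D (F * G) = fps_lift D F * G + F * fps_lift D G"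
proof -
  have D0: "D 0 = 0" using assms(1)[of 0 0] by simp
  have Ds: "D (sum f A) = (\<Sum>i\<in>A. D (f i))" for f :: "nat \<Rightarrow> 'b" and A
    by (induction A rule: infinite_finite_induct) (auto simp: assms D0)
  show ?thesis by (rule fps_ext) (simp add: fps_mult_nth Ds assms(2) sum.distrib)
qed

lemma fps_const_dvd_iff:
  fixes a :: "'b::comm_ring_1"
  shows "fps_const a dvd F \<longleftrightarrow> (\<forall>n. a dvd fps_nth F n)"
proof
  assume "\<forall>n. a dvd fps_nth F n"
  then obtain g where "\<And>n. fps_nth F n = a * g n" unfolding dvd_def by metis
  then have "F = fps_const a * Abs_fps g" by (intro fps_ext) simp
  then show "fps_const a dvd F" by simp
qed auto

lemma fps_decompose: "F = fps_const (fps_nth F 0) + fps_X * fps_shift 1 F" for F :: "'b::comm_ring_1 fps"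
  by (rule fps_ext) (simp add: fps_X_mult_nth)

text \<open>Splitting off the constant term lowers the index of the coefficient in question, so
  constants control the whole map. With \<open>a = 0\<close> this becomes a device for proving
  identities.\<close>

lemma fps_const_dvd_linear:
  fixes T :: "'b::comm_ring_1 fps \<Rightarrow> 'c::comm_ring_1 fps"
  assumes add: "\<And>F G. T (F + G) = T F + T G" and X: "\<And>F. T (fps_X * F) = fps_X * T F"
    and const: "\<And>p. fps_const a dvd T (fps_const p)"
  shows "fps_const a dvd T F"
proof -
  have "a dvd fps_nth (T F) n" for n
  proof (induction n arbitrary: F rule: less_induct)
    case (less n)
    have "T F = T (fps_const (fps_nth F 0)) + fps_X * T (fps_shift 1 F)"
      by (subst (1) fps_decompose) (simp only: add X)
    then have "fps_nth (T F) n = fps_nth (T (fps_const (fps_nth F 0))) n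
        + (if n = 0 then 0 else fps_nth (T (fps_shift 1 F)) (n - 1))"
      by (simp add: fps_X_mult_nth)
    then show ?case using const[of "fps_nth F 0"] less.IH[of "n - 1" "fps_shift 1 F"]
      by (auto simp: fps_const_dvd_iff intro!: dvd_add)
  qed
  then show ?thesis by (simp add: fps_const_dvd_iff)
qed

abbreviation Dx :: "'a::field_char_0 poly3 fps \<Rightarrow> 'a poly3 fps" where "Dx \<equiv> fps_lift dx"
abbreviation Dy :: "'a::field_char_0 poly3 fps \<Rightarrow> 'a poly3 fps" where "Dy \<equiv> fps_lift dy"
abbreviation Dz :: "'a::field_char_0 poly3 fps \<Rightarrow> 'a poly3 fps" where "Dz \<equiv> fps_lift dz"

lemma Dx_add: "Dx (F + G) = Dx F + Dx G" and Dy_add: "Dy (F + G) = Dy F + Dy G"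
  and Dz_add: "Dz (F + G) = Dz F + Dz G"
  by (rule fps_ext; simp add: dx_add dy_add dz_add)+

lemma Dx_diff: "Dx (F - G) = Dx F - Dx G" and Dy_diff: "Dy (F - G) = Dy F - Dy G"
  and Dz_diff: "Dz (F - G) = Dz F - Dz G"
  by (rule fps_ext; simp add: partial_diff)+

lemma Dx_mult: "Dx (F * G) = Dx F * G + F * Dx G" and Dy_mult: "Dy (F * G) = Dy F * G + F * Dy G"
  and Dz_mult: "Dz (F * G) = Dz F * G + F * Dz G"
  by (rule fps_lift_mult; simp add: dx_add dy_add dz_add dx_mult dy_mult dz_mult)+

lemma D_const: "Dx (fps_const p) = fps_const (dx p)" "Dy (fps_const p) = fps_const (dy p)"
  "Dz (fps_const p) = fps_const (dz p)"
  by (rule fps_ext; simp add: partial_0)+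

lemma D_X: "Dx fps_X = 0" "Dy fps_X = 0" "Dz fps_X = 0"
  by (rule fps_ext; simp add: fps_X_def partial_0)+

lemma D_0: "Dx 0 = 0" "Dy 0 = 0" "Dz 0 = 0" "Dx 1 = 0" "Dy 1 = 0" "Dz 1 = 0"
  by (rule fps_ext; simp add: partial_0 fps_one_nth)+

lemma D_commute: "Dy (Dx F) = Dx (Dy F)" "Dz (Dx F) = Dx (Dz F)" "Dz (Dy F) = Dy (Dz F)"
  by (rule fps_ext; simp add: partial_commute)+

lemma D_power: "Dx (F ^ k) = of_nat k * F ^ (k - 1) * Dx F" "Dy (F ^ k) = of_nat k * F ^ (k - 1) * Dy F"
  "Dz (F ^ k) = of_nat k * F ^ (k - 1) * Dz F"
proof -
  have "D (F ^ k) = of_nat k * F ^ (k - 1) * D F" if "\<And>F G. D (F * G) = D F * G + F * D G" "D 1 = 0"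
    for D :: "'a poly3 fps \<Rightarrow> 'a poly3 fps"
  proof (induction k)
    case (Suc k)
    then show ?case by (cases k) (simp_all add: that algebra_simps)
  qed (simp add: that)
  from this[of Dx] this[of Dy] this[of Dz]
  show "Dx (F ^ k) = of_nat k * F ^ (k - 1) * Dx F" "Dy (F ^ k) = of_nat k * F ^ (k - 1) * Dy F"
    "Dz (F ^ k) = of_nat k * F ^ (k - 1) * Dz F"
    by (simp_all add: Dx_mult Dy_mult Dz_mult D_0)
qed

text \<open>The extension of \<open>jac_bracket\<close> to power series, written with
  coefficientwise derivatives so that its identities become ring arithmetic.\<close>

definition fps_bracket :: "'a::field_char_0 poly3 \<Rightarrow> 'a poly3 fps \<Rightarrow> 'a poly3 fps \<Rightarrow> 'a poly3 fps" where
  "fps_bracket \<phi> F G =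
     fps_const (dx \<phi>) * (Dy F * Dz G - Dz F * Dy G) +
     fps_const (dy \<phi>) * (Dz F * Dx G - Dx F * Dz G) +
     fps_const (dz \<phi>) * (Dx F * Dy G - Dy F * Dx G)"

lemma fps_bracket_nth:
  "fps_nth (fps_bracket \<phi> F G) n = (\<Sum>j\<le>n. jac_bracket \<phi> (fps_nth F j) (fps_nth G (n - j)))"
  unfolding fps_bracket_def fps_add_nth fps_mult_left_const_nth fps_sub_nth
  by (simp add: fps_mult_nth jac_bracket_def atLeast0AtMost sum.distrib sum_subtractf
     flip: sum_distrib_left)

lemma fps_bracket_const: "fps_bracket \<phi> (fps_const p) (fps_const q) = fps_const (jac_bracket \<phi> p q)"
  by (simp add: fps_bracket_def jac_bracket_def D_const fps_const_add[symmetric] fps_const_sub[symmetric]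
    fps_const_mult[symmetric] del: fps_const_add fps_const_sub fps_const_mult)

lemma fps_bracket_add:
  "fps_bracket \<phi> (F + F') G = fps_bracket \<phi> F G + fps_bracket \<phi> F' G"
  "fps_bracket \<phi> F (G + G') = fps_bracket \<phi> F G + fps_bracket \<phi> F G'"
  by (simp_all add: fps_bracket_def Dx_add Dy_add Dz_add algebra_simps)

lemma fps_bracket_mult:
  "fps_bracket \<phi> (F * F') G = F * fps_bracket \<phi> F' G + F' * fps_bracket \<phi> F G"
  "fps_bracket \<phi> F (G * G') = G * fps_bracket \<phi> F G' + G' * fps_bracket \<phi> F G"
  by (simp_all add: fps_bracket_def Dx_mult Dy_mult Dz_mult algebra_simps)

lemma fps_bracket_X: "fps_bracket \<phi> (fps_X * F) G = fps_X * fps_bracket \<phi> F G"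
  "fps_bracket \<phi> F (fps_X * G) = fps_X * fps_bracket \<phi> F G"
proof -
  have "fps_bracket \<phi> fps_X G = 0" for G by (simp add: fps_bracket_def D_X)
  moreover have "fps_bracket \<phi> F fps_X = 0" for F by (simp add: fps_bracket_def D_X)
  ultimately show "fps_bracket \<phi> (fps_X * F) G = fps_X * fps_bracket \<phi> F G"
    "fps_bracket \<phi> F (fps_X * G) = fps_X * fps_bracket \<phi> F G"
    by (simp_all add: fps_bracket_mult)
qed

text \<open>The extra factor \<open>F\<close> in the first two equations avoids the exponent
  \<open>k - 1\<close> and its special case \<open>k = 0\<close>.\<close>

lemma fps_bracket_power:
  "F * fps_bracket \<phi> (F ^ k) G = of_nat k * F ^ k * fps_bracket \<phi> F G"
  "F * fps_bracket \<phi> G (F ^ k) = of_nat k * F ^ k * fps_bracket \<phi> G F"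
  "fps_bracket \<phi> (F ^ k) (F ^ l) = 0"
proof -
  have "fps_bracket \<phi> (F ^ k) G = of_nat k * F ^ (k - 1) * fps_bracket \<phi> F G"
    "fps_bracket \<phi> G (F ^ k) = of_nat k * F ^ (k - 1) * fps_bracket \<phi> G F" for k G
    by (simp_all add: fps_bracket_def D_power algebra_simps)
  moreover have "fps_bracket \<phi> F F = 0" by (simp add: fps_bracket_def algebra_simps)
  moreover have "F * (of_nat k * F ^ (k - 1)) = of_nat k * F ^ k" by (cases k) (simp_all add: algebra_simps)
  ultimately show "F * fps_bracket \<phi> (F ^ k) G = of_nat k * F ^ k * fps_bracket \<phi> F G"
    "F * fps_bracket \<phi> G (F ^ k) = of_nat k * F ^ k * fps_bracket \<phi> G F"
    "fps_bracket \<phi> (F ^ k) (F ^ l) = 0"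
    by (simp_all flip: mult.assoc)
qed

section \<open>The Jacobi identity\<close>

definition det3 :: "'r \<Rightarrow> 'r \<Rightarrow> 'r \<Rightarrow> 'r \<Rightarrow> 'r \<Rightarrow> 'r \<Rightarrow> 'r \<Rightarrow> 'r \<Rightarrow> 'r \<Rightarrow> 'r::comm_ring_1" where
  "det3 a1 a2 a3 b1 b2 b3 c1 c2 c3 = a1 * (b2 * c3 - b3 * c2) + a2 * (b3 * c1 - b1 * c3) + a3 * (b1 * c2 - b2 * c1)"

lemma det3_add: "det3 a1 a2 a3 (b1 + b1') (b2 + b2') (b3 + b3') c1 c2 c3
    = det3 a1 a2 a3 b1 b2 b3 c1 c2 c3 + det3 a1 a2 a3 b1' b2' b3' c1 c2 c3"
  by (simp add: det3_def algebra_simps)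

text \<open>Here \<open>p\<close> to \<open>u\<close> are the entries of a symmetric matrix, to be
  the Hessian of one argument of the bracket. Its symmetry cancels the terms with these second
  derivatives between two cyclic summands.\<close>

lemma det3_hessian:
  fixes a1 a2 a3 g1 g2 g3 h1 h2 h3 p q r s t u :: "'r::comm_ring_1"
  shows "det3 a1 a2 a3 (det3 a1 a2 a3 p q r g1 g2 g3) (det3 a1 a2 a3 q s t g1 g2 g3)
      (det3 a1 a2 a3 r t u g1 g2 g3) h1 h2 h3
    + det3 a1 a2 a3 (det3 a1 a2 a3 h1 h2 h3 p q r) (det3 a1 a2 a3 h1 h2 h3 q s t)
      (det3 a1 a2 a3 h1 h2 h3 r t u) g1 g2 g3 = 0"
  unfolding det3_def by (simp add: algebra_simps)

text \<open>The symmetric matrix will now be the Hessian of \<phi>, whose entries cancel over the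
  full cyclic sum.\<close>

lemma det3_hessian':
  fixes a1 a2 a3 f1 f2 f3 g1 g2 g3 h1 h2 h3 p q r s t u :: "'r::comm_ring_1"
  shows "det3 a1 a2 a3 (det3 p q r f1 f2 f3 g1 g2 g3) (det3 q s t f1 f2 f3 g1 g2 g3)
      (det3 r t u f1 f2 f3 g1 g2 g3) h1 h2 h3
    + det3 a1 a2 a3 (det3 p q r g1 g2 g3 h1 h2 h3) (det3 q s t g1 g2 g3 h1 h2 h3)
      (det3 r t u g1 g2 g3 h1 h2 h3) f1 f2 f3
    + det3 a1 a2 a3 (det3 p q r h1 h2 h3 f1 f2 f3) (det3 q s t h1 h2 h3 f1 f2 f3)
      (det3 r t u h1 h2 h3 f1 f2 f3) g1 g2 g3 = 0"
  unfolding det3_def by (simp add: algebra_simps)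

lemma fps_bracket_det3: "fps_bracket \<phi> F G = det3 (fps_const (dx \<phi>)) (fps_const (dy \<phi>)) (fps_const (dz \<phi>))
    (Dx F) (Dy F) (Dz F) (Dx G) (Dy G) (Dz G)"
  by (simp add: fps_bracket_def det3_def)

lemma derivation_det3:
  assumes "\<And>F G. D (F + G) = D F + D G" "\<And>F G. D (F - G) = D F - D G" "\<And>F G. D (F * G) = D F * G + F * D G"
  shows "D (det3 a1 a2 a3 b1 b2 b3 c1 c2 c3) = det3 (D a1) (D a2) (D a3) b1 b2 b3 c1 c2 c3
    + det3 a1 a2 a3 (D b1) (D b2) (D b3) c1 c2 c3 + det3 a1 a2 a3 b1 b2 b3 (D c1) (D c2) (D c3)"
  by (simp add: det3_def assms algebra_simps)

lemma fps_bracket_jacobi: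
  "fps_bracket \<phi> (fps_bracket \<phi> F G) H + fps_bracket \<phi> (fps_bracket \<phi> G H) F
    + fps_bracket \<phi> (fps_bracket \<phi> H F) G = 0"
proof -
  let ?d = "det3 (fps_const (dx \<phi>)) (fps_const (dy \<phi>)) (fps_const (dz \<phi>))"
  \<comment> \<open>The summands \<open>?p\<close>, \<open>?l\<close>, \<open>?r\<close> collect the
    terms of the double bracket in which the outer derivative hits the gradient of \<phi>, of the
    first and of the second argument.\<close>
  let ?p = "\<lambda>F G H. ?d (det3 (fps_const (dx (dx \<phi>))) (fps_const (dx (dy \<phi>))) (fps_const (dx (dz \<phi>)))
      (Dx F) (Dy F) (Dz F) (Dx G) (Dy G) (Dz G)) (det3 (fps_const (dx (dy \<phi>))) (fps_const (dy (dy \<phi>))) (fps_const (dy (dz \<phi>)))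
      (Dx F) (Dy F) (Dz F) (Dx G) (Dy G) (Dz G)) (det3 (fps_const (dx (dz \<phi>))) (fps_const (dy (dz \<phi>))) (fps_const (dz (dz \<phi>)))
      (Dx F) (Dy F) (Dz F) (Dx G) (Dy G) (Dz G)) (Dx H) (Dy H) (Dz H)"
  let ?l = "\<lambda>F G H. ?d (?d (Dx (Dx F)) (Dx (Dy F)) (Dx (Dz F)) (Dx G) (Dy G) (Dz G))
      (?d (Dx (Dy F)) (Dy (Dy F)) (Dy (Dz F)) (Dx G) (Dy G) (Dz G))
      (?d (Dx (Dz F)) (Dy (Dz F)) (Dz (Dz F)) (Dx G) (Dy G) (Dz G)) (Dx H) (Dy H) (Dz H)"
  let ?r = "\<lambda>F G H. ?d (?d (Dx F) (Dy F) (Dz F) (Dx (Dx G)) (Dx (Dy G)) (Dx (Dz G)))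
      (?d (Dx F) (Dy F) (Dz F) (Dx (Dy G)) (Dy (Dy G)) (Dy (Dz G)))
      (?d (Dx F) (Dy F) (Dz F) (Dx (Dz G)) (Dy (Dz G)) (Dz (Dz G))) (Dx H) (Dy H) (Dz H)"
  have e: "fps_bracket \<phi> (fps_bracket \<phi> F G) H = ?p F G H + ?l F G H + ?r F G H" for F G H
    unfolding fps_bracket_det3
    by (simp only: derivation_det3[of Dx] derivation_det3[of Dy] derivation_det3[of Dz]
      Dx_add Dy_add Dz_add Dx_diff Dy_diff Dz_diff Dx_mult Dy_mult Dz_mult det3_add D_const D_commute partial_commute)
  have "?p F G H + ?p G H F + ?p H F G = 0" by (rule det3_hessian')
  moreover have "?l F G H + ?r H F G = 0" for F G H by (rule det3_hessian)
  from this[of F G H] this[of G H F] this[of H F G]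
  have "(?l F G H + ?r H F G) + (?l G H F + ?r F G H) + (?l H F G + ?r G H F) = 0" by (simp only: add_0)
  ultimately have "(?p F G H + ?p G H F + ?p H F G)
    + ((?l F G H + ?r H F G) + (?l G H F + ?r F G H) + (?l H F G + ?r G H F)) = 0" by (simp only: add_0)
  then show ?thesis unfolding e by (simp only: ac_simps)
qed

text \<open>The bracket is a bivector of rank two.\<close>

lemma fps_bracket_plucker:
  "fps_bracket \<phi> F G * fps_bracket \<phi> V H + fps_bracket \<phi> G H * fps_bracket \<phi> V F
    + fps_bracket \<phi> H F * fps_bracket \<phi> V G = 0"
  by (simp add: fps_bracket_def algebra_simps)

text \<open>The Leibniz rule separates \<open>V * V\<close> times the Jacobi sum of the bracket from
  the terms that differentiate \<open>V\<close>, and these form the rank two relation.\<close>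

lemma mult_fps_bracket_jacobi:
  "V * fps_bracket \<phi> (V * fps_bracket \<phi> F G) H + V * fps_bracket \<phi> (V * fps_bracket \<phi> G H) F
    + V * fps_bracket \<phi> (V * fps_bracket \<phi> H F) G = 0" (is "?L = 0")
proof -
  have "?L = V * V * (fps_bracket \<phi> (fps_bracket \<phi> F G) H + fps_bracket \<phi> (fps_bracket \<phi> G H) F
      + fps_bracket \<phi> (fps_bracket \<phi> H F) G)
    + V * (fps_bracket \<phi> F G * fps_bracket \<phi> V H + fps_bracket \<phi> G H * fps_bracket \<phi> V F
      + fps_bracket \<phi> H F * fps_bracket \<phi> V G)"
    unfolding fps_bracket_mult by (simp add: algebra_simps)
  then show ?thesis by (simp add: fps_bracket_jacobi fps_bracket_plucker)
qed

lemma comm_ring_hom_fps_const: "comm_ring_hom (fps_const :: 'b::comm_ring_1 \<Rightarrow> 'b fps)"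
  by unfold_locales simp_all

section \<open>The rescaling automorphisms\<close>

context weights
begin

lemma homogeneous_induct [case_names homogeneous add]:
  assumes "\<And>p k. homogeneous p (int k) \<Longrightarrow> P p" and "\<And>p q. P p \<Longrightarrow> P q \<Longrightarrow> P (p + q)"
  shows "P p"
proof -
  have "P (sum f A)" if "\<And>i. P (f i)" for f and A :: "nat set"
    by (induction A rule: infinite_finite_induct) (auto intro: assms that simp: homogeneous_def E_0)
  then show ?thesis using sum_hcomp[of p] homogeneous_hcomp assms(1) by metis
qed

text \<open>Each term differentiates \<phi>, \<open>p\<close> and \<open>q\<close> in three
  different variables, so every weight is lost exactly once.\<close>

lemma homogeneous_jac_bracket:
  assumes "homogeneous \<phi> d" "homogeneous p k" "homogeneous q l"
  shows "homogeneous (jac_bracket \<phi> p q) (k + l + d - int (w1 + w2 + w3))"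
proof -
  note h = homogeneous_partial[OF assms(1)] homogeneous_partial[OF assms(2)] homogeneous_partial[OF assms(3)]
  have m: "homogeneous (a * (b * c - b' * c')) n"
    if "homogeneous a i" "homogeneous b j" "homogeneous c r" "homogeneous b' j'" "homogeneous c' r'"
      "i + j + r = n" "i + j' + r' = n" for a b c b' c' i j r j' r' n
  proof -
    have "j + r = j' + r'" using that by simp
    then have "homogeneous (b * c - b' * c') (j + r)"
      using homogeneous_mult[OF that(2,3)] homogeneous_mult[OF that(4,5)] by (simp add: homogeneous_diff)
    from homogeneous_mult[OF that(1) this] show ?thesis using that(6) by (simp add: add.assoc)
  qed
  show ?thesis unfolding jac_bracket_def
    by (intro homogeneous_add; rule m, (rule h)+) simp_all
qed

abbreviation EE :: "'a::field_char_0 poly3 fps \<Rightarrow> 'a poly3 fps" where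
  "EE \<equiv> fps_lift E"

lemma EE_eq: "EE F = fps_const (of_nat w1 * varx) * Dx F + fps_const (of_nat w2 * vary) * Dy F
    + fps_const (of_nat w3 * varz) * Dz F"
  by (rule fps_ext) (simp add: euler_def)

text \<open>Cramer's rule for the Euler field and the gradients of \<open>\<phi>\<close>, \<open>F\<close>, \<open>H\<close>, \<open>L\<close>.\<close>

lemma EE_bracket:
  "\<exists>R. EE F * fps_bracket \<phi> L H + EE H * fps_bracket \<phi> F L = EE L * fps_bracket \<phi> F H + fps_const (E \<phi>) * R"
proof
  have "fps_const (E \<phi>) = fps_const (of_nat w1 * varx) * fps_const (dx \<phi>)
      + fps_const (of_nat w2 * vary) * fps_const (dy \<phi>) + fps_const (of_nat w3 * varz) * fps_const (dz \<phi>)"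
    by (simp add: euler_def)
  \<comment> \<open>The error is minus the determinant of the gradients of \<open>F\<close>,
    \<open>H\<close>, \<open>L\<close>. For homogeneous \<phi> its factor \<open>E \<phi>\<close> is
    a multiple of \<phi>, hence zero on the surface.\<close>
  then show "EE F * fps_bracket \<phi> L H + EE H * fps_bracket \<phi> F L = EE L * fps_bracket \<phi> F H
    + fps_const (E \<phi>) * (Dx F * (Dz H * Dy L - Dy H * Dz L) + Dy F * (Dx H * Dz L - Dz H * Dx L)
        + Dz F * (Dy H * Dx L - Dx H * Dy L))"
    unfolding EE_eq fps_bracket_def by (simp only:) (simp only: algebra_simps)
qed

definition rescale_const :: "'a::field_char_0 poly3 fps \<Rightarrow> 'a poly3 \<Rightarrow> 'a poly3 fps" where
  "rescale_const \<sigma> p = poly (map_poly fps_const (G p)) \<sigma>"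

text \<open>The automorphism with \<open>x \<mapsto> \<sigma> ^ w1 * x\<close>, \<open>y \<mapsto> \<sigma> ^ w2 * y\<close>, \<open>z \<mapsto> \<sigma> ^ w3 * z\<close>.\<close>

definition rescale :: "'a::field_char_0 poly3 fps \<Rightarrow> 'a poly3 fps \<Rightarrow> 'a poly3 fps" where
  "rescale \<sigma> F = Abs_fps (\<lambda>n. \<Sum>j\<le>n. fps_nth (rescale_const \<sigma> (fps_nth F j)) (n - j))"

lemma rescale_const_hom: "comm_ring_hom (rescale_const \<sigma>)"
proof -
  interpret p: comm_ring_hom "\<lambda>p. poly (map_poly fps_const p) \<sigma>"
    by (rule comm_ring_hom.comm_ring_hom_poly) (rule comm_ring_hom_fps_const)
  show ?thesis unfolding rescale_const_def
    by unfold_locales (simp_all add: G.hom_add G.hom_mult p.hom_add p.hom_mult p.hom_one)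
qed

lemma rescale_const_homogeneous: "homogeneous p (int k) \<Longrightarrow> rescale_const \<sigma> p = fps_const p * \<sigma> ^ k"
  by (simp add: rescale_const_def G_homogeneous map_poly_monom poly_monom)

lemma rescale_const_const3: "rescale_const \<sigma> (const3 c) = fps_const (const3 c)"
  using rescale_const_homogeneous[of "const3 c" 0 \<sigma>] by (simp add: homogeneous_def E_const3)

context
  fixes \<sigma> :: "'a::field_char_0 poly3 fps"
begin

interpretation c: comm_ring_hom "rescale_const \<sigma>" by (rule rescale_const_hom)

lemma rescale_add: "rescale \<sigma> (F + F') = rescale \<sigma> F + rescale \<sigma> F'"
  by (rule fps_ext) (simp add: rescale_def c.hom_add sum.distrib)

lemma rescale_const: "rescale \<sigma> (fps_const p) = rescale_const \<sigma> p"
proof (rule fps_ext)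
  fix n
  have "fps_nth (rescale \<sigma> (fps_const p)) n = (\<Sum>j\<le>n. if j = 0 then fps_nth (rescale_const \<sigma> p) n else 0)"
    unfolding rescale_def fps_nth_Abs_fps by (rule sum.cong) (auto simp: c.hom_zero)
  then show "fps_nth (rescale \<sigma> (fps_const p)) n = fps_nth (rescale_const \<sigma> p) n" by simp
qed

lemma rescale_X: "rescale \<sigma> (fps_X * F) = fps_X * rescale \<sigma> F"
proof (rule fps_ext)
  fix n
  show "fps_nth (rescale \<sigma> (fps_X * F)) n = fps_nth (fps_X * rescale \<sigma> F) n"
  proof (cases n)
    case (Suc m)
    then show ?thesis unfolding rescale_def fps_X_mult_nth
      by (simp only: fps_nth_Abs_fps sum.atMost_Suc_shift) simp
  qed (simp add: rescale_def)
qed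

lemma rescale_mult: "rescale \<sigma> (F * F') = rescale \<sigma> F * rescale \<sigma> F'"
proof -
  have 1: "rescale \<sigma> (fps_const p * F') - rescale \<sigma> (fps_const p) * rescale \<sigma> F' = 0" for p F'
  proof -
    let ?T = "\<lambda>F'. rescale \<sigma> (fps_const p * F') - rescale \<sigma> (fps_const p) * rescale \<sigma> F'"
    \<comment> \<open>Divisibility by zero means vanishing; the two arguments are reduced to
      constants one after the other.\<close>
    have "fps_const 0 dvd ?T F'"
    proof (rule fps_const_dvd_linear[where T = ?T])
      show "fps_const 0 dvd ?T (fps_const q)" for q by (simp add: rescale_const c.hom_mult)
      show "?T (fps_X * F) = fps_X * ?T F" for F
        using rescale_X[of "fps_const p * F"] rescale_X[of F] by (simp add: algebra_simps)
    qed (simp add: rescale_add algebra_simps)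
    then show ?thesis by simp
  qed
  let ?T = "\<lambda>F. rescale \<sigma> (F * F') - rescale \<sigma> F * rescale \<sigma> F'"
  have "fps_const 0 dvd ?T F"
  proof (rule fps_const_dvd_linear[where T = ?T])
    show "fps_const 0 dvd ?T (fps_const p)" for p by (simp only: 1 dvd_0_right)
    show "?T (fps_X * F) = fps_X * ?T F" for F
      using rescale_X[of "F * F'"] rescale_X[of F] by (simp add: algebra_simps)
  qed (simp add: rescale_add algebra_simps)
  then show ?thesis by simp
qed

lemma rescale_1: "rescale \<sigma> 1 = 1"
  using rescale_const[of 1] by (simp add: c.hom_one)

lemma rescale_0: "rescale \<sigma> 0 = 0"
  using rescale_const[of 0] by simp

lemma rescale_diff: "rescale \<sigma> (F - F') = rescale \<sigma> F - rescale \<sigma> F'"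
  using rescale_add[of "F - F'" F'] by (simp add: algebra_simps)

lemma rescale_nth_0:
  assumes "fps_nth \<sigma> 0 = 1"
  shows "fps_nth (rescale \<sigma> F) 0 = fps_nth F 0"
proof -
  have "fps_nth (rescale_const \<sigma> p) 0 = p" for p
  proof (induction p rule: homogeneous_induct)
    case (homogeneous p k)
    then show ?case by (simp add: rescale_const_homogeneous fps_nth_power_0 assms)
  qed (simp add: c.hom_add)
  then show ?thesis by (simp add: rescale_def)
qed

end

lemma rescale_fps_lift_const3: "rescale \<sigma> (fps_lift const3 c) = fps_lift const3 c"
proof (rule fps_ext)
  fix n
  have "fps_nth (rescale \<sigma> (fps_lift const3 c)) n = (\<Sum>j\<le>n. if j = n then const3 (fps_nth c n) else 0)"
    unfolding rescale_def fps_nth_Abs_fps by (rule sum.cong) (auto simp: rescale_const_const3)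
  then show "fps_nth (rescale \<sigma> (fps_lift const3 c)) n = fps_nth (fps_lift const3 c) n" by simp
qed

text \<open>The factor \<open>\<sigma> ^ w\<close> turns a possibly negative exponent
  \<open>j\<close> into the natural number \<open>n\<close>; for negative \<open>j\<close> both
  sides vanish.\<close>

lemma rescale_homogeneous:
  assumes h: "homogeneous p j" and n: "j + int w = int n"
  shows "\<sigma> ^ w * rescale \<sigma> (fps_const p) = \<sigma> ^ n * fps_const p"
proof (cases "j < 0")
  case True
  then have "p = 0" by (rule homogeneous_negative[OF h])
  then show ?thesis by (simp add: rescale_0)
next
  case False
  then obtain k where j: "j = int k" by (metis nonneg_int_cases not_less)
  then have "n = w + k" using n by simp
  then show ?thesis using h by (simp add: j rescale_const rescale_const_homogeneous power_add algebra_simps)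
qed

end

section \<open>Normalizing a multiple of the bracket\<close>

lemma fps_X_power_dvd_iff:
  fixes F :: "'b::comm_ring_1 fps"
  shows "fps_X ^ n dvd F \<longleftrightarrow> (\<forall>i<n. fps_nth F i = 0)"
proof
  assume "\<forall>i<n. fps_nth F i = 0"
  then have "F = fps_X ^ n * fps_shift n F"
    by (intro fps_ext) (simp add: fps_X_power_mult_nth)
  then show "fps_X ^ n dvd F" by (rule dvdI)
qed (auto simp: fps_X_power_mult_nth)

lemma dvd_mult_diff:
  fixes x :: "'b::comm_ring_1"
  assumes "x dvd a - a'" "x dvd b - b'"
  shows "x dvd a * b - a' * b'"
proof -
  have "a * b - a' * b' = (a - a') * b + a' * (b - b')" by (simp add: algebra_simps)
  then show ?thesis using assms by (simp only:) (intro dvd_add dvd_mult dvd_mult2)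
qed

lemma dvd_power_diff:
  fixes x :: "'b::comm_ring_1"
  assumes "x dvd a - a'"
  shows "x dvd a ^ k - a' ^ k"
  by (induction k) (use assms in \<open>auto intro: dvd_mult_diff\<close>)

text \<open>The binomial expansion to first order: the constant term 1 of \<open>F\<close> makes the
  leading coefficient of the change \<open>k * a\<close>.\<close>

lemma fps_perturb_power:
  fixes F :: "'b::comm_ring_1 fps"
  assumes "fps_nth F 0 = 1"
  shows "\<exists>Z. (F + fps_X ^ Suc n * fps_const a) ^ k = F ^ k + fps_X ^ Suc n * Z \<and> fps_nth Z 0 = of_nat k * a"
proof (induction k)
  case 0
  show ?case by (intro exI[of _ 0]) simp
next
  case (Suc k)
  then obtain Z where Z: "(F + fps_X ^ Suc n * fps_const a) ^ k = F ^ k + fps_X ^ Suc n * Z"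
    "fps_nth Z 0 = of_nat k * a" by blast
  show ?case
  proof (intro exI conjI)
    show "(F + fps_X ^ Suc n * fps_const a) ^ Suc k
        = F ^ Suc k + fps_X ^ Suc n * (F * Z + fps_const a * F ^ k + fps_X ^ Suc n * fps_const a * Z)"
      by (simp only: power_Suc[of "F + fps_X ^ Suc n * fps_const a"] power_Suc[of F] Z) (simp only: algebra_simps)
    show "fps_nth (F * Z + fps_const a * F ^ k + fps_X ^ Suc n * fps_const a * Z) 0 = of_nat (Suc k) * a"
      using assms Z(2) by (simp add: fps_nth_power_0 algebra_simps)
  qed
qed

section \<open>Transport of the bracket under rescaling\<close>

context weights
begin

text \<open>On degree \<open>k\<close> rescaling multiplies by \<open>\<sigma> ^ k\<close>.
  Differentiating these powers produces \<open>EE P * ?B \<sigma> Q + EE Q * ?B P \<sigma>\<close>,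
  which Cramer's rule turns into \<open>EE \<sigma> * ?B P Q\<close> modulo \<phi>; hence the factor
  \<open>\<sigma> + EE \<sigma>\<close>. The prefactor absorbs one power lost by differentiation and
  \<open>w1 + w2 + w3\<close> powers for the degree shift of the bracket.\<close>

lemma rescale_bracket_homogeneous:
  assumes \<phi>: "homogeneous \<phi> (int d)" and p: "homogeneous p (int k)" and q: "homogeneous q (int l)"
    and eq: "\<sigma> ^ (w1 + w2 + w3) * V' * (\<sigma> + EE \<sigma>) = rescale \<sigma> V * \<sigma> ^ Suc d"
  shows "fps_const \<phi> dvd \<sigma> ^ Suc (w1 + w2 + w3) * (rescale \<sigma> (V * fps_bracket \<phi> (fps_const p) (fps_const q))
    - V' * fps_bracket \<phi> (rescale \<sigma> (fps_const p)) (rescale \<sigma> (fps_const q)))"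
proof -
  define w where "w = w1 + w2 + w3"
  define P Q f where PQ: "P = fps_const p" "Q = fps_const q" "f = fps_const \<phi>"
  have E: "EE P = of_nat k * P" "EE Q = of_nat l * Q" "fps_const (E \<phi>) = of_nat d * f"
    using p q \<phi> by (auto simp: PQ homogeneous_def E_0 fps_of_nat[symmetric] intro!: fps_ext)
  have r: "rescale \<sigma> P = P * \<sigma> ^ k" "rescale \<sigma> Q = Q * \<sigma> ^ l"
    using p q by (simp_all add: PQ rescale_const rescale_const_homogeneous)
  let ?B = "fps_bracket \<phi>"
  have "\<sigma> ^ w * rescale \<sigma> (fps_const (jac_bracket \<phi> p q)) = \<sigma> ^ (k + l + d) * fps_const (jac_bracket \<phi> p q)"
    by (rule rescale_homogeneous[OF homogeneous_jac_bracket[OF \<phi> p q]]) (simp add: w_def)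
  then have rB: "\<sigma> ^ w * rescale \<sigma> (?B P Q) = \<sigma> ^ (k + l + d) * ?B P Q"
    by (simp add: PQ fps_bracket_const)
  obtain R where R: "EE P * ?B \<sigma> Q + EE Q * ?B P \<sigma> = EE \<sigma> * ?B P Q + fps_const (E \<phi>) * R"
    using EE_bracket[of P \<phi> \<sigma> Q] by blast
  have "\<sigma> * ?B (P * \<sigma> ^ k) (Q * \<sigma> ^ l) =
    P * Q * (\<sigma> * ?B (\<sigma> ^ k) (\<sigma> ^ l)) + P * \<sigma> ^ l * (\<sigma> * ?B (\<sigma> ^ k) Q) + \<sigma> ^ k * Q * (\<sigma> * ?B P (\<sigma> ^ l))
    + \<sigma> ^ k * \<sigma> ^ l * \<sigma> * ?B P Q"
    by (simp only: fps_bracket_mult) (simp only: algebra_simps)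
  also have "\<dots> = \<sigma> ^ k * \<sigma> ^ l * ((EE P * ?B \<sigma> Q + EE Q * ?B P \<sigma>) + \<sigma> * ?B P Q)"
    unfolding fps_bracket_power E by (simp add: algebra_simps)
  finally have b: "\<sigma> * ?B (P * \<sigma> ^ k) (Q * \<sigma> ^ l)
      = \<sigma> ^ k * \<sigma> ^ l * ((\<sigma> + EE \<sigma>) * ?B P Q) + f * (\<sigma> ^ k * \<sigma> ^ l * of_nat d * R)"
    unfolding R by (simp add: E(3) algebra_simps)
  have "\<sigma> ^ Suc w * (rescale \<sigma> (V * ?B P Q) - V' * ?B (P * \<sigma> ^ k) (Q * \<sigma> ^ l))
      = \<sigma> * rescale \<sigma> V * (\<sigma> ^ w * rescale \<sigma> (?B P Q)) - \<sigma> ^ w * V' * (\<sigma> * ?B (P * \<sigma> ^ k) (Q * \<sigma> ^ l))"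
    by (simp add: rescale_mult algebra_simps)
  also have "\<dots> = (rescale \<sigma> V * \<sigma> ^ Suc d - \<sigma> ^ w * V' * (\<sigma> + EE \<sigma>)) * (\<sigma> ^ k * \<sigma> ^ l * ?B P Q)
      - f * (\<sigma> ^ w * V' * (\<sigma> ^ k * \<sigma> ^ l * of_nat d * R))"
    unfolding rB b by (simp add: algebra_simps power_add)
  also have "rescale \<sigma> V * \<sigma> ^ Suc d - \<sigma> ^ w * V' * (\<sigma> + EE \<sigma>) = 0"
    using eq by (simp add: w_def)
  finally show ?thesis unfolding PQ[symmetric] r w_def[symmetric] by simp
qed

text \<open>Additivity in each argument and compatibility with \<open>fps_X\<close> reduce to
  homogeneous constants, where powers of the inverse \<tau> cancel the prefactor.\<close>

lemma rescale_bracket: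
  assumes \<phi>: "homogeneous \<phi> (int d)" and inv: "\<sigma> * \<tau> = 1"
    and eq: "\<sigma> ^ (w1 + w2 + w3) * V' * (\<sigma> + EE \<sigma>) = rescale \<sigma> V * \<sigma> ^ Suc d"
  shows "fps_const \<phi> dvd rescale \<sigma> (V * fps_bracket \<phi> F H) - V' * fps_bracket \<phi> (rescale \<sigma> F) (rescale \<sigma> H)"
proof -
  let ?T = "\<lambda>F H. rescale \<sigma> (V * fps_bracket \<phi> F H) - V' * fps_bracket \<phi> (rescale \<sigma> F) (rescale \<sigma> H)"
  let ?s = "\<sigma> ^ Suc (w1 + w2 + w3)"
  have add1: "?T (F + F') H = ?T F H + ?T F' H" and add2: "?T F (H + H') = ?T F H + ?T F H'" for F F' H H'
    by (simp_all add: fps_bracket_add rescale_add distrib_left)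
  have X1: "?T (fps_X * F) H = fps_X * ?T F H" and X2: "?T F (fps_X * H) = fps_X * ?T F H" for F H
    using rescale_X[of \<sigma> "V * fps_bracket \<phi> F H"]
    by (simp_all add: fps_bracket_X rescale_X mult.left_commute[of _ fps_X] right_diff_distrib)
  have const: "fps_const \<phi> dvd ?T (fps_const p) (fps_const q)" for p q
  proof -
    have "fps_const \<phi> dvd ?s * ?T (fps_const p) (fps_const q)"
    proof (induction p rule: homogeneous_induct)
      case (homogeneous p k)
      show ?case
      proof (induction q rule: homogeneous_induct)
        case (homogeneous q l)
        show ?case by (rule rescale_bracket_homogeneous[OF \<phi> _ homogeneous eq]) fact
      next
        case (add q q')
        have "?s * ?T (fps_const p) (fps_const (q + q')) = ?s * ?T (fps_const p) (fps_const q) + ?s * ?T (fps_const p) (fps_const q')"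
          by (simp only: fps_const_add[symmetric] add2 distrib_left)
        then show ?case using add by (simp only: dvd_add)
      qed
    next
      case (add p p')
      have "?s * ?T (fps_const (p + p')) (fps_const q) = ?s * ?T (fps_const p) (fps_const q) + ?s * ?T (fps_const p') (fps_const q)"
        by (simp only: fps_const_add[symmetric] add1 distrib_left)
      then show ?case using add by (simp only: dvd_add)
    qed
    then have "fps_const \<phi> dvd \<tau> ^ Suc (w1 + w2 + w3) * (?s * ?T (fps_const p) (fps_const q))" by (rule dvd_mult)
    also have "\<tau> ^ Suc (w1 + w2 + w3) * (?s * ?T (fps_const p) (fps_const q)) = (\<sigma> * \<tau>) ^ Suc (w1 + w2 + w3) * ?T (fps_const p) (fps_const q)"
      by (simp only: power_mult_distrib mult_ac)
    finally show ?thesis by (simp only: inv power_one mult_1_left)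
  qed
  have const': "fps_const \<phi> dvd ?T (fps_const p) H" for p
    by (rule fps_const_dvd_linear[where T = "?T (fps_const p)"]) (rule add2 X2 const)+
  show ?thesis
    by (rule fps_const_dvd_linear[where T = "\<lambda>F. ?T F H"]) (rule add1 X1 const')+
qed

text \<open>The guard keeps truncated subtraction from selecting degree 0 when
  \<open>d - (w1 + w2 + w3)\<close> is negative as an integer.\<close>

definition critical :: "nat \<Rightarrow> 'a::field_char_0 poly3 \<Rightarrow> 'a poly3" where
  "critical d p = (if w1 + w2 + w3 \<le> d then hcomp (d - (w1 + w2 + w3)) p else 0)"

text \<open>Off the critical degree the operator \<open>E - (d - (w1 + w2 + w3))\<close> is invertible.\<close>

lemma cohomological_equation:
  "\<exists>q. critical d p + E q + of_nat (w1 + w2 + w3) * q - of_nat d * q = p"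
proof (induction p rule: homogeneous_induct)
  case (homogeneous p k)
  show ?case
  proof (cases "k + (w1 + w2 + w3) = d")
    case True
    then have "critical d p = p" using hcomp_homogeneous[OF homogeneous, of k] by (auto simp: critical_def)
    then show ?thesis by (intro exI[of _ 0]) (simp add: E_0)
  next
    case False
    then have c: "critical d p = 0" using hcomp_homogeneous[OF homogeneous] by (auto simp: critical_def)
    \<comment> \<open>The eigenvalue of the operator on degree \<open>k\<close>, nonzero off the
      critical degree by characteristic zero.\<close>
    let ?c = "of_nat (k + (w1 + w2 + w3)) - of_nat d :: 'a"
    have c0: "?c \<noteq> 0" using False by (metis eq_iff_diff_eq_0 of_nat_eq_iff)
    have cc: "const3 ?c = of_nat (k + (w1 + w2 + w3)) - (of_nat d :: 'a poly3)"
      using const3_hom(1)[of ?c "of_nat d"] by (simp add: of_nat_poly3 eq_diff_eq)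
    let ?q = "const3 (1 / ?c) * p"
    have "E ?q = of_nat k * ?q"
      using homogeneous by (simp add: E_mult E_const3 homogeneous_def mult.left_commute)
    then have "E ?q + of_nat (w1 + w2 + w3) * ?q - of_nat d * ?q = const3 ?c * const3 (1 / ?c) * p"
      unfolding cc by (simp add: algebra_simps)
    also have "\<dots> = p" using c0 by (simp only: const3_hom(2)[symmetric]) (simp add: const3_hom)
    finally show ?thesis using c by (intro exI[of _ ?q]) simp
  qed
next
  case (add p q)
  then obtain p' q' where "critical d p + E p' + of_nat (w1 + w2 + w3) * p' - of_nat d * p' = p"
    "critical d q + E q' + of_nat (w1 + w2 + w3) * q' - of_nat d * q' = q" by blast
  moreover have "critical d (p + q) + E (p' + q') + of_nat (w1 + w2 + w3) * (p' + q') - of_nat d * (p' + q')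
      = (critical d p + E p' + of_nat (w1 + w2 + w3) * p' - of_nat d * p')
        + (critical d q + E q' + of_nat (w1 + w2 + w3) * q' - of_nat d * q')"
    by (simp add: critical_def hcomp_add E_add algebra_simps)
  ultimately have "critical d (p + q) + E (p' + q') + of_nat (w1 + w2 + w3) * (p' + q') - of_nat d * (p' + q') = p + q"
    by (simp only:)
  then show ?case by blast
qed

section \<open>Solving the transport equation order by order\<close>

lemma rescale_cong:
  assumes "fps_X ^ N dvd \<sigma> - \<sigma>'"
  shows "fps_X ^ N dvd rescale \<sigma> F - rescale \<sigma>' F"
proof -
  have c: "fps_X ^ N dvd rescale \<sigma> (fps_const p) - rescale \<sigma>' (fps_const p)" for p
  proof (induction p rule: homogeneous_induct)
    case (homogeneous p k)
    then show ?case using dvd_mult[OF dvd_power_diff[OF assms, of k], of "fps_const p"]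
      by (simp add: rescale_const rescale_const_homogeneous right_diff_distrib)
  next
    case (add p q)
    have "rescale \<sigma> (fps_const (p + q)) - rescale \<sigma>' (fps_const (p + q)) =
      (rescale \<sigma> (fps_const p) - rescale \<sigma>' (fps_const p)) + (rescale \<sigma> (fps_const q) - rescale \<sigma>' (fps_const q))"
      by (simp only: fps_const_add[symmetric] rescale_add) simp
    then show ?case using add by (simp only: dvd_add)
  qed
  \<comment> \<open>Shifting \<open>F\<close> gains a factor \<open>fps_X\<close>, so the inductive
    step uses the congruence one order lower, for arbitrary \<open>F\<close>.\<close>
  have "fps_X ^ M dvd rescale \<sigma> F - rescale \<sigma>' F" if "M \<le> N" for M
    using that
  proof (induction M arbitrary: F)
    case (Suc M)
    have "rescale \<sigma> F - rescale \<sigma>' F = (rescale \<sigma> (fps_const (fps_nth F 0)) - rescale \<sigma>' (fps_const (fps_nth F 0)))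
      + fps_X * (rescale \<sigma> (fps_shift 1 F) - rescale \<sigma>' (fps_shift 1 F))"
      by (subst (1 2) fps_decompose) (simp only: rescale_add rescale_X right_diff_distrib, simp)
    moreover have "fps_X ^ Suc M dvd rescale \<sigma> (fps_const (fps_nth F 0)) - rescale \<sigma>' (fps_const (fps_nth F 0))"
      using le_imp_power_dvd[OF Suc.prems, of fps_X] c by (rule dvd_trans)
    moreover have "fps_X ^ Suc M dvd fps_X * (rescale \<sigma> (fps_shift 1 F) - rescale \<sigma>' (fps_shift 1 F))"
      using Suc by (simp add: mult_dvd_mono)
    ultimately show ?case by (simp only: dvd_add)
  qed simp
  then show ?thesis by blast
qed

text \<open>Its vanishing is the transport equation assumed in
  \<open>rescale_bracket\<close>.\<close>

definition defect :: "nat \<Rightarrow> 'a::field_char_0 poly3 fps \<Rightarrow> 'a poly3 fps \<Rightarrow> 'a poly3 fps \<Rightarrow> 'a poly3 fps" where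
  "defect d V \<sigma> V' = \<sigma> ^ (w1 + w2 + w3) * V' * (\<sigma> + EE \<sigma>) - rescale \<sigma> V * \<sigma> ^ Suc d"

lemma EE_add: "EE (F + F') = EE F + EE F'"
  by (rule fps_ext) (simp add: E_add)

lemma defect_cong:
  assumes "fps_X ^ N dvd \<sigma> - \<sigma>'" "fps_X ^ N dvd W - W'"
  shows "fps_X ^ N dvd defect d V \<sigma> W - defect d V \<sigma>' W'"
proof -
  have "fps_X ^ N dvd EE \<sigma> - EE \<sigma>'"
    using assms(1) by (auto simp: fps_X_power_dvd_iff)
  then have "fps_X ^ N dvd (\<sigma> - \<sigma>') + (EE \<sigma> - EE \<sigma>')" by (rule dvd_add[OF assms(1)])
  then have "fps_X ^ N dvd (\<sigma> + EE \<sigma>) - (\<sigma>' + EE \<sigma>')" by (simp add: algebra_simps)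
  from dvd_mult_diff[OF dvd_mult_diff[OF dvd_power_diff[OF assms(1)] assms(2)] this]
    dvd_mult_diff[OF rescale_cong[OF assms(1)] dvd_power_diff[OF assms(1)]]
  have "fps_X ^ N dvd (\<sigma> ^ (w1 + w2 + w3) * W * (\<sigma> + EE \<sigma>) - \<sigma>' ^ (w1 + w2 + w3) * W' * (\<sigma>' + EE \<sigma>'))
    - (rescale \<sigma> V * \<sigma> ^ Suc d - rescale \<sigma>' V * \<sigma>' ^ Suc d)"
    by (rule dvd_diff)
  then show ?thesis by (simp add: defect_def algebra_simps)
qed

text \<open>As \<sigma>, \<open>V\<close> and \<open>W\<close> start with 1, the leading coefficient
  of the defect changes by the linear operator of \<open>cohomological_equation\<close>; its
  solution cancels that coefficient.\<close>

lemma defect_step: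
  assumes V: "fps_nth V 0 = 1" and s: "fps_nth \<sigma> 0 = 1" and W: "fps_nth W 0 = 1"
    and dvd: "fps_X ^ Suc n dvd defect d V \<sigma> W"
  shows "\<exists>p q. fps_X ^ Suc (Suc n) dvd defect d V (\<sigma> + fps_X ^ Suc n * fps_const p)
    (W + fps_X ^ Suc n * fps_const (critical d q))"
proof -
  obtain D where D: "defect d V \<sigma> W = fps_X ^ Suc n * D" using dvd by (elim dvdE)
  obtain p where p: "critical d (- fps_nth D 0) + E p + of_nat (w1 + w2 + w3) * p - of_nat d * p = - fps_nth D 0"
    using cohomological_equation by blast
  define q where "q = critical d (- fps_nth D 0)"
  define x :: "'a poly3 fps" where "x = fps_X ^ Suc n"
  have x0: "fps_nth x 0 = 0" by (simp add: x_def)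
  let ?s = "\<sigma> + x * fps_const p" and ?W = "W + x * fps_const q"
  obtain a where a: "?s ^ (w1 + w2 + w3) = \<sigma> ^ (w1 + w2 + w3) + x * a" "fps_nth a 0 = of_nat (w1 + w2 + w3) * p"
    using fps_perturb_power[OF s] unfolding x_def by blast
  obtain b where b: "?s ^ Suc d = \<sigma> ^ Suc d + x * b" "fps_nth b 0 = of_nat (Suc d) * p"
    using fps_perturb_power[OF s] unfolding x_def by blast
  have EEs: "?s + EE ?s = (\<sigma> + EE \<sigma>) + x * fps_const (p + E p)"
  proof -
    have "EE (x * fps_const p) = x * fps_const (E p)"
      by (rule fps_ext) (simp add: x_def fps_X_power_mult_nth E_0 del: power_Suc)
    then show ?thesis by (simp add: EE_add algebra_simps flip: fps_const_add)
  qed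
  \<comment> \<open>Since \<open>V\<close> starts with 1, which rescaling fixes, perturbing \<sigma>
    affects \<open>rescale \<sigma> V\<close> only one order later; hence the extra
    \<open>fps_X\<close>.\<close>
  obtain z where z: "rescale ?s V = rescale \<sigma> V + x * (fps_X * z)"
  proof -
    have r: "rescale \<rho> V = 1 + fps_X * rescale \<rho> (fps_shift 1 V)" for \<rho>
      by (subst fps_decompose) (simp only: rescale_add rescale_X V fps_const_1_eq_1 rescale_1)
    have "x dvd rescale ?s (fps_shift 1 V) - rescale \<sigma> (fps_shift 1 V)"
      unfolding x_def by (rule rescale_cong) simp
    then obtain z where "rescale ?s (fps_shift 1 V) - rescale \<sigma> (fps_shift 1 V) = x * z" by (elim dvdE)
    then have "rescale ?s (fps_shift 1 V) = rescale \<sigma> (fps_shift 1 V) + x * z" by (simp add: diff_eq_eq)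
    then have "rescale ?s V = rescale \<sigma> V + x * (fps_X * z)" by (simp only: r) (simp only: algebra_simps)
    then show ?thesis by (rule that)
  qed
  let ?A = "\<sigma> ^ (w1 + w2 + w3)" and ?C = "\<sigma> + EE \<sigma>" and ?c = "fps_const (p + E p)" and ?q = "fps_const q"
  let ?Q = "a * W * ?C + ?A * ?q * ?C + ?A * W * ?c + x * (a * ?q * ?C + a * W * ?c + ?A * ?q * ?c) + x * x * (a * ?q * ?c)
    - (rescale \<sigma> V * b + fps_X * z * \<sigma> ^ Suc d + fps_X * x * z * b)"
  have "defect d V ?s ?W = defect d V \<sigma> W + x * ?Q"
    unfolding defect_def a b EEs z by (simp only: algebra_simps)
  then have "defect d V ?s ?W = x * (D + ?Q)" by (simp only: D x_def distrib_left)
  moreover have "fps_X dvd D + ?Q"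
  proof -
    have "fps_nth (D + ?Q) 0 = fps_nth D 0 + (of_nat (w1 + w2 + w3) * p + q + (p + E p) - of_nat (Suc d) * p)"
      using s W V x0 a(2) b(2) by (simp add: fps_nth_power_0 rescale_nth_0[OF s] E_0)
    also have "\<dots> = 0" using p by (simp add: q_def algebra_simps)
    finally show ?thesis using fps_X_power_dvd_iff[of 1 "D + ?Q"] by simp
  qed
  ultimately have "fps_X ^ Suc (Suc n) dvd defect d V ?s ?W"
    by (simp add: x_def mult_dvd_mono power_Suc2[of _ "Suc n"] del: power_Suc)
  then show ?thesis unfolding x_def q_def by blast
qed

text \<open>Dependent choice iterates \<open>defect_step\<close>. Each stage alters only
  coefficients beyond those already settled, so the stages converge coefficientwise.\<close>

lemma defect_solution:
  assumes V: "fps_nth V 0 = 1"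
  shows "\<exists>\<sigma> W. fps_nth \<sigma> 0 = 1 \<and> fps_nth W 0 = 1 \<and> (\<forall>n>0. \<exists>q. fps_nth W n = critical d q) \<and> defect d V \<sigma> W = 0"
proof -
  let ?P = "\<lambda>n (\<sigma>, W). fps_nth \<sigma> 0 = 1 \<and> fps_nth W 0 = 1 \<and> (\<forall>i>0. \<exists>q. fps_nth W i = critical d q)
    \<and> fps_X ^ Suc n dvd defect d V \<sigma> W"
  let ?R = "\<lambda>n (\<sigma>, W) (\<sigma>', W'). fps_X ^ Suc n dvd \<sigma>' - \<sigma> \<and> fps_X ^ Suc n dvd W' - W"
  have "\<exists>f. \<forall>n. ?P n (f n) \<and> ?R n (f n) (f (Suc n))"
  proof (rule dependent_nat_choice)
    \<comment> \<open>The iteration starts at \<open>\<sigma> = W = 1\<close>, where both sides of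
      the equation have constant coefficient 1.\<close>
    have "EE 1 = 0" by (rule fps_ext) (simp add: fps_one_nth E_0)
    then have "fps_nth (defect d V 1 1) 0 = 0" by (simp add: defect_def rescale_nth_0 V E_0)
    then have "fps_X ^ Suc 0 dvd defect d V 1 1" by (subst fps_X_power_dvd_iff) simp
    moreover have "critical d 0 = 0" by (simp add: critical_def)
    ultimately show "\<exists>x. ?P 0 x" by (intro exI[of _ "(1, 1)"]) (auto intro!: exI[of _ "0 :: 'a poly3"])
  next
    fix x n assume "?P n x"
    obtain \<sigma> W where x: "x = (\<sigma>, W)" by (cases x)
    have P: "fps_nth \<sigma> 0 = 1" "fps_nth W 0 = 1" "\<forall>i>0. \<exists>q. fps_nth W i = critical d q"
      "fps_X ^ Suc n dvd defect d V \<sigma> W" using \<open>?P n x\<close> by (simp_all add: x)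
    obtain p q where d: "fps_X ^ Suc (Suc n) dvd defect d V (\<sigma> + fps_X ^ Suc n * fps_const p)
      (W + fps_X ^ Suc n * fps_const (critical d q))"
      using defect_step[OF V P(1,2,4)] by blast
    have "\<exists>q'. fps_nth (W + fps_X ^ Suc n * fps_const (critical d q)) i = critical d q'" if i: "i > 0" for i
    proof -
      obtain q' where q': "fps_nth W i = critical d q'" using P(3) i by blast
      show ?thesis
      proof (cases "i = Suc n")
        case True
        then show ?thesis using q' by (intro exI[of _ "q' + q"])
          (simp add: fps_X_power_mult_nth critical_def hcomp_add del: power_Suc)
      next
        case False
        then show ?thesis using q' by (intro exI[of _ q']) (auto simp: fps_X_power_mult_nth simp del: power_Suc)
      qed
    qed
    then show "\<exists>y. ?P (Suc n) y \<and> ?R n x y"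
      using P d by (intro exI[of _ "(\<sigma> + fps_X ^ Suc n * fps_const p, W + fps_X ^ Suc n * fps_const (critical d q))"])
        (simp add: x)
  qed
  then obtain f where f: "\<forall>n. ?P n (f n) \<and> ?R n (f n) (f (Suc n))" by (rule exE)
  define s t where st: "s n = fst (f n)" "t n = snd (f n)" for n
  have P: "fps_nth (s n) 0 = 1" "fps_nth (t n) 0 = 1" "\<forall>i>0. \<exists>q. fps_nth (t n) i = critical d q"
    "fps_X ^ Suc n dvd defect d V (s n) (t n)" for n
    using f[rule_format, of n] by (simp_all add: st case_prod_beta)
  have R: "fps_nth (s (Suc n)) i = fps_nth (s n) i" "fps_nth (t (Suc n)) i = fps_nth (t n) i" if i: "i \<le> n" for n i
  proof -
    have "fps_X ^ Suc n dvd s (Suc n) - s n" "fps_X ^ Suc n dvd t (Suc n) - t n"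
      using f[rule_format, of n] by (simp_all add: st case_prod_beta)
    then show "fps_nth (s (Suc n)) i = fps_nth (s n) i" "fps_nth (t (Suc n)) i = fps_nth (t n) i"
      unfolding fps_X_power_dvd_iff using i by auto
  qed
  have R': "fps_nth (s n) i = fps_nth (s i) i \<and> fps_nth (t n) i = fps_nth (t i) i" if "i \<le> n" for n i
    using that by (induction n rule: dec_induct) (simp_all add: R)
  \<comment> \<open>Coefficient \<open>i\<close> is final from stage \<open>i\<close> on, so these
    diagonal series agree with stage \<open>n\<close> up to order \<open>n\<close>.\<close>
  define \<sigma> W where SW: "\<sigma> = Abs_fps (\<lambda>n. fps_nth (s n) n)" "W = Abs_fps (\<lambda>n. fps_nth (t n) n)"
  have "fps_X ^ Suc n dvd defect d V \<sigma> W" for n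
  proof -
    have "fps_nth (\<sigma> - s n) i = 0" "fps_nth (W - t n) i = 0" if "i < Suc n" for i
      using R'[of i n] that by (simp_all add: SW)
    then have "fps_X ^ Suc n dvd \<sigma> - s n" "fps_X ^ Suc n dvd W - t n"
      unfolding fps_X_power_dvd_iff by blast+
    from dvd_add[OF defect_cong[OF this, of d V] P(4)[of n]] show ?thesis by simp
  qed
  then have "defect d V \<sigma> W = 0"
    unfolding fps_X_power_dvd_iff by (intro fps_ext) auto
  moreover have "fps_nth \<sigma> 0 = 1" "fps_nth W 0 = 1" "\<forall>n>0. \<exists>q. fps_nth W n = critical d q"
    using P by (simp_all add: SW)
  ultimately show ?thesis by blast
qed

end

section \<open>Deformations of the surface\<close>

lemma jac_bracket_derivation:
  "jac_bracket \<phi> p (q + q') = jac_bracket \<phi> p q + jac_bracket \<phi> p q'"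
  "jac_bracket \<phi> (p + p') q = jac_bracket \<phi> p q + jac_bracket \<phi> p' q"
  "jac_bracket \<phi> p (const3 c) = 0"
  "jac_bracket \<phi> (const3 c) q = 0"
  "jac_bracket \<phi> p (q * q') = jac_bracket \<phi> p q * q' + q * jac_bracket \<phi> p q'"
  "jac_bracket \<phi> (p * p') q = jac_bracket \<phi> p q * p' + p * jac_bracket \<phi> p' q"
  and jac_bracket_skew: "jac_bracket \<phi> p q = - jac_bracket \<phi> q p"
  by (simp_all add: jac_bracket_def dx_add dy_add dz_add dx_mult dy_mult dz_mult partial_simps algebra_simps)

section \<open>Power series over the surface algebra\<close>

context surface
begin

text \<open>Every element of \<open>fps_alg Q\<close> has this form, which turns computations there
  into arithmetic of polynomial power series.\<close>

definition coset_fps :: "'a poly3 fps \<Rightarrow> nat \<Rightarrow> 'a poly3 set" where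
  "coset_fps F n = cs (fps_nth F n)"

lemma coset_fps_eq_iff: "coset_fps F = coset_fps H \<longleftrightarrow> fps_const \<phi> dvd F - H"
  by (simp add: fun_eq_iff coset_fps_def cs_eq_dvd fps_const_dvd_iff)

lemma carrier_fps_alg: "carrier (fps_alg Q) = range coset_fps"
proof
  show "carrier (fps_alg Q) \<subseteq> range coset_fps"
  proof
    fix X assume "X \<in> carrier (fps_alg Q)"
    then have "\<forall>n. \<exists>p. X n = cs p" by (auto simp: fps_alg_def carrier_Q)
    then obtain f where "\<And>n. X n = cs (f n)" by metis
    then have "X = coset_fps (Abs_fps f)" by (simp add: fun_eq_iff coset_fps_def)
    then show "X \<in> range coset_fps" by blast
  qed
qed (auto simp: fps_alg_def coset_fps_def cs_in_carrier)

lemma coset_fps_simps: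
  "coset_fps F \<oplus>\<^bsub>fps_alg Q\<^esub> coset_fps H = coset_fps (F + H)"
  "coset_fps F \<otimes>\<^bsub>fps_alg Q\<^esub> coset_fps H = coset_fps (F * H)"
  "\<zero>\<^bsub>fps_alg Q\<^esub> = coset_fps 0" "\<one>\<^bsub>fps_alg Q\<^esub> = coset_fps 1"
  "c \<odot>\<^bsub>fps_alg Q\<^esub> coset_fps F = coset_fps (fps_lift const3 c * F)"
  by (simp_all add: fps_alg_def coset_fps_def fun_eq_iff cs_simps cs_finsum fps_mult_nth atLeast0AtMost fps_one_nth)

lemma deform_map_coset_fps:
  assumes "\<And>n p q. \<pi> n (cs p) (cs q) = cs (fps_nth V n * jac_bracket \<phi> p q)"
  shows "deform_map Q \<pi> (coset_fps F) (coset_fps H) = coset_fps (V * fps_bracket \<phi> F H)"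
  by (simp add: deform_map_def coset_fps_def fun_eq_iff assms cs_finsum fps_mult_nth fps_bracket_nth
    sum_distrib_left atLeast0AtMost)

text \<open>All orders are assembled into one map, \<open>V\<close> times the bracket, whose Jacobi
  identity is \<open>mult_fps_bracket_jacobi\<close>.\<close>

lemma formal_deformation_multiple:
  assumes \<pi>: "\<And>n p q. \<pi> n (cs p) (cs q) = cs (fps_nth V n * jac_bracket \<phi> p q)" and V: "fps_nth V 0 = 1"
  shows "formal_deformation Q (surf_bracket \<phi>) \<pi>"
  unfolding formal_deformation_def
proof (intro conjI allI ballI)
  fix X Y assume "X \<in> carrier Q" "Y \<in> carrier Q"
  then obtain p q where "X = cs p" "Y = cs q" by (auto simp: carrier_Q)
  then show "\<pi> 0 X Y = surf_bracket \<phi> X Y" by (simp add: \<pi> V surf_bracket_coset)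
next
  fix n
  have "\<pi> n (cs p) (cs q) = \<ominus>\<^bsub>Q\<^esub> \<pi> n (cs q) (cs p)" for p q
    using jac_bracket_skew[of \<phi> p q] by (simp add: \<pi> cs_uminus)
  moreover have "derivation Q (\<pi> n (cs p))" "derivation Q (\<lambda>X. \<pi> n X (cs p))" for p
    by (auto simp: derivation_def module_hom_def carrier_Q \<pi> cs_simps jac_bracket_derivation algebra_simps)
  ultimately show "skew_biderivation Q (\<pi> n)" unfolding skew_biderivation_def carrier_Q by blast
next
  note d = deform_map_coset_fps[where \<pi> = \<pi> and V = V, OF \<pi>]
  show "jacobi (fps_alg Q) (deform_map Q \<pi>)"
    by (auto simp: jacobi_def carrier_fps_alg d coset_fps_simps mult_fps_bracket_jacobi)
qed

lemma surf_deformation_coset: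
  assumes "finite K"
  shows "surf_deformation \<phi> u K \<alpha> n (cs p) (cs q)
    = cs (fps_nth (Abs_fps (\<lambda>n. if n = 0 then 1 else \<Sum>j\<in>K. const3 (\<alpha> n j) * u j)) n * jac_bracket \<phi> p q)"
proof (cases "n = 0")
  case False
  have "surf_deformation \<phi> u K \<alpha> n (cs p) (cs q)
    = (\<Oplus>\<^bsub>Q\<^esub>j\<in>K. cs (const3 (\<alpha> n j) * (u j * jac_bracket \<phi> p q)))"
    using False by (simp add: surf_deformation_def A_surf_eq surf_op_mult_grad_coset cs_simps)
  then show ?thesis using False assms by (simp add: cs_finsum sum_distrib_right mult.assoc)
qed (simp add: surf_deformation_def surf_bracket_coset)

lemma formal_deformation_surf:
  assumes "finite K"
  shows "formal_deformation (A_surf \<phi>) (surf_bracket \<phi>) (surf_deformation \<phi> u K \<alpha>)"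
  unfolding A_surf_eq by (rule formal_deformation_multiple[OF surf_deformation_coset[OF assms]]) simp

end

section \<open>Reduction to the normal form\<close>

context isolated_surface
begin

lemma formal_deformation_is_multiple:
  assumes "formal_deformation Q (surf_bracket \<phi>) \<pi>"
  shows "\<exists>V. fps_nth V 0 = 1 \<and> (\<forall>n p q. \<pi> n (cs p) (cs q) = cs (fps_nth V n * jac_bracket \<phi> p q))"
proof -
  have "\<forall>n. \<exists>k. \<forall>p q. \<pi> n (cs p) (cs q) = cs (k * jac_bracket \<phi> p q)"
    using assms biderivation_surface unfolding formal_deformation_def A_surf_eq by blast
  then obtain k where k: "\<And>n p q. \<pi> n (cs p) (cs q) = cs (k n * jac_bracket \<phi> p q)" by metis
  have "\<pi> 0 (cs p) (cs q) = cs (1 * jac_bracket \<phi> p q)" for p q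
    using assms cs_in_carrier by (simp add: formal_deformation_def surf_bracket_coset)
  \<comment> \<open>The multiplier of order 0 is replaced by exactly 1, the constant term that
    solving the transport equation assumes.\<close>
  with k show ?thesis by (intro exI[of _ "Abs_fps (\<lambda>n. if n = 0 then 1 else k n)"]) simp
qed

lemma equivalent_deformations_rescale:
  assumes \<pi>: "\<And>n p q. \<pi> n (cs p) (cs q) = cs (fps_nth V n * jac_bracket \<phi> p q)"
    and \<pi>': "\<And>n p q. \<pi>' n (cs p) (cs q) = cs (fps_nth W n * jac_bracket \<phi> p q)"
    and \<sigma>: "fps_nth \<sigma> 0 = 1" and eq: "defect d V \<sigma> W = 0"
  shows "equivalent_deformations Q \<pi> \<pi>'"
proof -
  \<comment> \<open>Homogeneity makes rescaling multiply \<phi> by \<open>\<sigma> ^ d\<close>, so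
    the ideal of \<phi> is preserved and the map descends to cosets.\<close>
  have wd: "coset_fps (rescale \<sigma> F) = coset_fps (rescale \<sigma> H)" if FH: "coset_fps F = coset_fps H" for F H
  proof -
    obtain R where "F - H = fps_const \<phi> * R" using FH by (auto simp: coset_fps_eq_iff elim: dvdE)
    then have "rescale \<sigma> F - rescale \<sigma> H = fps_const \<phi> * \<sigma> ^ d * rescale \<sigma> R"
      by (simp add: rescale_mult rescale_const rescale_const_homogeneous[OF hom] flip: rescale_diff)
    then show ?thesis by (simp add: coset_fps_eq_iff mult.assoc)
  qed
  define \<Phi> where "\<Phi> X = coset_fps (rescale \<sigma> (SOME F. coset_fps F = X))" for X
  have \<Phi>: "\<Phi> (coset_fps F) = coset_fps (rescale \<sigma> F)" for F
    unfolding \<Phi>_def by (rule wd) (rule someI[of _ F], rule refl)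
  have inv: "\<sigma> * fps_right_inverse \<sigma> 1 = 1" by (rule fps_right_inverse) (simp add: \<sigma>)
  have "\<Phi> (deform_map Q \<pi> (coset_fps F) (coset_fps H)) = deform_map Q \<pi>' (\<Phi> (coset_fps F)) (\<Phi> (coset_fps H))" for F H
    unfolding \<Phi> deform_map_coset_fps[where \<pi> = \<pi> and V = V, OF \<pi>]
      deform_map_coset_fps[where \<pi> = \<pi>' and V = W, OF \<pi>'] coset_fps_eq_iff
    by (rule rescale_bracket[OF hom inv]) (use eq in \<open>simp add: defect_def\<close>)
  moreover have "\<Phi> \<in> Ring.ring_hom (fps_alg Q) (fps_alg Q)"
    by (rule ring_hom_memI) (auto simp: carrier_fps_alg \<Phi> coset_fps_simps rescale_mult rescale_add rescale_1)
  moreover have "\<Phi> \<in> module_hom class_ring (fps_alg Q) (fps_alg Q)"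
    by (auto simp: module_hom_def carrier_fps_alg \<Phi> coset_fps_simps rescale_mult rescale_add rescale_fps_lift_const3)
  moreover have "\<Phi> (coset_fps F) 0 = coset_fps F 0" for F
    by (simp add: \<Phi> coset_fps_def rescale_nth_0[OF \<sigma>])
  ultimately show ?thesis unfolding equivalent_deformations_def carrier_fps_alg by blast
qed

lemma critical_eq_sum:
  assumes "K = {j. j < \<mu> \<and> int (e j) = int d - int (w1 + w2 + w3)}"
  shows "\<exists>c. critical d p = (\<Sum>j\<in>K. const3 (c j) * u j)"
proof (cases "w1 + w2 + w3 \<le> d")
  case True
  then have "K = {j. j < \<mu> \<and> e j = d - (w1 + w2 + w3)}" using assms by auto
  then show ?thesis using hcomp_critical_degree[of "d - (w1 + w2 + w3)" p] True by (simp add: critical_def of_nat_diff)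
next
  case False
  then show ?thesis by (intro exI[of _ "\<lambda>_. 0"]) (simp add: critical_def const3_hom)
qed

lemma formal_deformation_equivalent:
  assumes K: "K = {j. j < \<mu> \<and> int (e j) = int d - int (w1 + w2 + w3)}"
    and \<pi>: "formal_deformation (A_surf \<phi>) (surf_bracket \<phi>) \<pi>"
  shows "\<exists>\<alpha>. equivalent_deformations (A_surf \<phi>) \<pi> (surf_deformation \<phi> u K \<alpha>)"
proof -
  have K_fin: "finite K" by (simp add: K)
  obtain V where V: "fps_nth V 0 = 1" "\<And>n p q. \<pi> n (cs p) (cs q) = cs (fps_nth V n * jac_bracket \<phi> p q)"
    using formal_deformation_is_multiple \<pi> unfolding A_surf_eq by blast
  obtain \<sigma> W where \<sigma>: "fps_nth \<sigma> 0 = 1" and W: "fps_nth W 0 = 1" "\<forall>n>0. \<exists>q. fps_nth W n = critical d q"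
    and eq: "defect d V \<sigma> W = 0"
    using defect_solution[OF V(1)] by blast
  have "\<exists>c. n > 0 \<longrightarrow> fps_nth W n = (\<Sum>j\<in>K. const3 (c j) * u j)" for n
    using W(2) critical_eq_sum[OF K] by metis
  then obtain \<alpha> where "\<And>n. n > 0 \<Longrightarrow> fps_nth W n = (\<Sum>j\<in>K. const3 (\<alpha> n j) * u j)" by metis
  then have "W = Abs_fps (\<lambda>n. if n = 0 then 1 else \<Sum>j\<in>K. const3 (\<alpha> n j) * u j)"
    using W(1) by (intro fps_ext) simp
  then have "surf_deformation \<phi> u K \<alpha> n (cs p) (cs q) = cs (fps_nth W n * jac_bracket \<phi> p q)" for n p q
    using surf_deformation_coset[OF K_fin] by simp
  from equivalent_deformations_rescale[where \<pi> = \<pi>, OF V(2) this \<sigma> eq] show ?thesis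
    unfolding A_surf_eq by blast
qed

end

theorem proposition3p9:
  fixes \<phi> :: "'a::field_char_0 poly3"
    and w1 w2 w3 d \<mu> :: nat
    and u :: "nat \<Rightarrow> 'a poly3"
    and e :: "nat \<Rightarrow> nat"
    and K :: "nat set"
  assumes weights: "w1 > 0" "w2 > 0" "w3 > 0" "Gcd {w1, w2, w3} = 1"
    and hom: "weight_homogeneous w1 w2 w3 \<phi> d"
    and isolated: "isolated_singularity \<phi>"
    and mu: "\<mu> = milnor_number \<phi>" "\<mu> \<ge> 1"
    and u_hom: "\<And>j. j < \<mu> \<Longrightarrow> weight_homogeneous w1 w2 w3 (u j) (e j)"
    and u_0: "u 0 = 1"
    and u_basis: "basis_family (A_sing \<phi>) \<mu> (\<lambda>j. jacobian_ideal \<phi> +>\<^bsub>poly3_alg\<^esub> u j)"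
    and K: "K = {j. j < \<mu> \<and> int (e j) = int d - int (w1 + w2 + w3)}"
  shows "(\<forall>\<alpha> :: nat \<Rightarrow> nat \<Rightarrow> 'a.
            formal_deformation (A_surf \<phi>) (surf_bracket \<phi>) (surf_deformation \<phi> u K \<alpha>)) \<and>
         (\<forall>\<pi>'. formal_deformation (A_surf \<phi>) (surf_bracket \<phi>) \<pi>' \<longrightarrow>
            (\<exists>\<alpha> :: nat \<Rightarrow> nat \<Rightarrow> 'a.
               equivalent_deformations (A_surf \<phi>) \<pi>' (surf_deformation \<phi> u K \<alpha>)))"
proof -
  interpret w: weights w1 w2 w3 by unfold_locales fact+
  interpret J: poly3_ideal "jacobian_ideal \<phi>" unfolding poly3_ideal_def by (rule jacobian_ideal_ideal)
  interpret isolated_surface w1 w2 w3 \<phi> d \<mu> u e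
  proof
    show "w.homogeneous \<phi> (int d)" "j < \<mu> \<Longrightarrow> w.homogeneous (u j) (int (e j))" for j
      using hom u_hom by (simp_all add: w.homogeneous_iff)
    \<comment> \<open>Spanning by the cosets, with explicit cofactors for the remainder in the
      Jacobian ideal, yields \<open>spans\<close>.\<close>
    fix p
    obtain c where "p - (\<Sum>j<\<mu>. const3 (c j) * u j) \<in> jacobian_ideal \<phi>"
      using J.spanned u_basis unfolding A_sing_def by blast
    then obtain f g h where "p - (\<Sum>j<\<mu>. const3 (c j) * u j) = f * dx \<phi> + g * dy \<phi> + h * dz \<phi>"
      using jacobian_ideal_subset by blast
    then have "p = (\<Sum>j<\<mu>. const3 (c j) * u j) + (f * dx \<phi> + g * dy \<phi> + h * dz \<phi>)"
      by (simp add: diff_eq_eq add.commute)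
    then show "\<exists>c f g h. p = (\<Sum>j<\<mu>. const3 (c j) * u j) + (f * dx \<phi> + g * dy \<phi> + h * dz \<phi>)" by blast
  qed
  have "finite K" by (simp add: K)
  then show ?thesis using formal_deformation_surf formal_deformation_equivalent[OF K] by blast
qed

end
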